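(* Let $q\geq 5$ be a prime number and let $f:\mathbb{N}\to\mathbb{C}$ be the unique multiplicative function that is $q$-periodic, has bounded partial sums, and satisfies $f(q)\neq 0$. Then $$\sum_{n\leq x}(f\ast f)(n)=\Omega(x^{1/4}).$$
   Context: $\mathbb{N}=\{1,2,3,\dots\}$. A function $f:\mathbb{N}\to\mathbb{C}$ is multiplicative if $f(1)=1$ and $f(nm)=f(n)f(m)$ whenever $n$ and $m$ are relatively prime. $f$ is $q$-periodic if $f(n+q)=f(n)$ for all $n\in\mathbb{N}$. $f$ has bounded partial sums if there exists a constant $C>0$ such that $|\sum_{n\leq x}f(n)|\leq C$ for all $x\geq 1$. $\ast$ denotes Dirichlet convolution, $(f\ast f)(n)=\sum_{d\mid n}f(d)f(n/d)$. For a function $S(x)$ and a positive function $g(x)$, $S(x)=\Omega(g(x))$ means $\limsup_{x\to\infty}\frac{|S(x)|}{g(x)}>0$ (possibly $+\infty$). *)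

theory Defs
  imports Complex_Main "HOL-Library.Extended_Real" "HOL-Computational_Algebra.Primes"
begin

text \<open>
  Arithmetic functions on the positive integers are modelled as functions of type
  \<^typ>\<open>nat \<Rightarrow> complex\<close>; the value at 0 is junk and no definition below depends on it.
\<close>

definition multiplicative_arith :: "(nat \<Rightarrow> complex) \<Rightarrow> bool" where
  "multiplicative_arith f \<longleftrightarrow>
     f 1 = 1 \<and> (\<forall>n\<ge>1. \<forall>m\<ge>1. coprime n m \<longrightarrow> f (n * m) = f n * f m)"

definition periodic_arith :: "nat \<Rightarrow> (nat \<Rightarrow> complex) \<Rightarrow> bool" where
  "periodic_arith q f \<longleftrightarrow> (\<forall>n\<ge>1. f (n + q) = f n)"

definition summatory :: "(nat \<Rightarrow> complex) \<Rightarrow> real \<Rightarrow> complex" where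
  "summatory f x = (\<Sum>n | 1 \<le> n \<and> real n \<le> x. f n)"

definition bounded_partial_sums :: "(nat \<Rightarrow> complex) \<Rightarrow> bool" where
  "bounded_partial_sums f \<longleftrightarrow> (\<exists>C>0. \<forall>x\<ge>1. norm (summatory f x) \<le> C)"

definition dirichlet_conv :: "(nat \<Rightarrow> complex) \<Rightarrow> (nat \<Rightarrow> complex) \<Rightarrow> nat \<Rightarrow> complex" where
  "dirichlet_conv f g n = (\<Sum>d | d dvd n. f d * g (n div d))"

text \<open>
  The Hardy--Littlewood notion of Omega: a positive limit superior, possibly infinite.
  It is weaker than the symbol \<open>\<Omega>\<close> of \<open>HOL-Library.Landau_Symbols\<close>, which asks for a
  lower bound for all sufficiently large arguments.
\<close>

definition is_Omega :: "(real \<Rightarrow> complex) \<Rightarrow> (real \<Rightarrow> real) \<Rightarrow> bool" where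
  "is_Omega S g \<longleftrightarrow> Limsup at_top (\<lambda>x. ereal (norm (S x) / g x)) > 0"

definition admissible :: "nat \<Rightarrow> (nat \<Rightarrow> complex) \<Rightarrow> bool" where
  "admissible q f \<longleftrightarrow>
     multiplicative_arith f \<and> periodic_arith q f \<and> bounded_partial_sums f \<and> f q \<noteq> 0"

end

theory Submission
  imports Defs "HOL-Analysis.Analysis"
begin

text \<open>
  The hypotheses determine \<open>f\<close>: it is \<open>1\<close> off the multiples of \<open>q\<close> and \<open>1 - q\<close> on them
  (\<open>admissible_unique\<close>). Its generating function \<open>P(w) = \<Sum>n\<ge>1. f(n) * exp (- n * w)\<close> is
  \<open>1 / (exp w - 1) - q / (exp (q * w) - 1)\<close>. It is regular at \<open>0\<close> and, on the imaginary axis,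
  its poles nearest to \<open>0\<close> are \<open>w0 = 2 * pi * \<i> / q\<close> and \<open>- w0\<close>.

  The \<open>\<Omega>\<close>-estimate comes from computing the integral over the real line of
  \<open>P(z * exp y) * P(z * exp (- y))\<close> in two ways, for \<open>z = \<delta> + w0\<close> and \<open>\<delta>\<close> tending to \<open>0\<close> from above.

  On the one hand, the integral of \<open>exp (- z * (m * exp y + n * exp (- y)))\<close> over \<open>y\<close> depends on
  \<open>m * n\<close> only. Expanding both factors shows that the integral is the sum of
  \<open>(f * f)(n) * K(z * sqrt n)\<close> over \<open>n\<close>, where \<open>f * f\<close> is the Dirichlet convolution and \<open>K\<close> is a
  Bessel-type kernel (\<open>bessel_series_tendsto\<close>).
  Consecutive values of \<open>K(z * sqrt n)\<close> differ by \<open>O(n powr (-3/4) * exp (- 2 * \<delta> * sqrt n))\<close>, a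
  stationary phase estimate that is uniform in \<open>\<delta>\<close> (\<open>norm_bessel_kernel_step_le\<close>). If the summatory
  function of \<open>f * f\<close> were \<open>o(x powr (1/4))\<close>, partial summation would bound the series by
  \<open>o(1 / \<delta>)\<close> (\<open>norm_bessel_series_le\<close>).

  On the other hand, as functions of \<open>y\<close> the two factors have poles on opposite sides of the real line, both at
  distance about \<open>\<delta> / norm w0\<close> from \<open>y = 0\<close>. They pinch the line of integration, and the integral is at least a
  constant times \<open>1 / \<delta>\<close>: the product of the two polar parts has positive real part and size \<open>1 / \<delta>\<^sup>2\<close>
  on an interval of length \<open>2 * \<delta>\<close> (\<open>pole_part_lower_bound\<close>), while \<open>\<delta>\<close> times everything else tends to
  \<open>0\<close> by dominated convergence (\<open>gen_product_integral_lower_bound\<close>). This is a contradiction.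
\<close>

section \<open>A Bessel-type kernel\<close>

lemma integrable_exp_neg_abs: "integrable lborel (\<lambda>y::real. exp (- \<bar>y\<bar>))"
proof -
  have "(\<lambda>y::real. exp (- y)) absolutely_integrable_on {0..}"
    by (rule nonnegative_absolutely_integrable_1)
       (use integrable_on_exp_minus_to_infinity[of 1 0] in auto)
  then have "set_integrable lborel {0..} (\<lambda>y::real. exp (- y))"
    unfolding set_integrable_def by (subst (asm) integrable_completion) auto
  then have pos: "integrable lborel (\<lambda>y::real. indicator {0..} y *\<^sub>R exp (- y))"
    by (simp add: set_integrable_def)
  then have neg: "integrable lborel (\<lambda>y::real. indicator {0..} (- y) *\<^sub>R exp (- (- y)))"
    using lborel_integrable_real_affine[OF pos, of "-1" 0] by (simp only: mult_minus1 add_0)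
  show ?thesis
    by (rule Bochner_Integration.integrable_bound[OF Bochner_Integration.integrable_add[OF pos neg]])
       (auto simp: indicator_def abs_if)
qed

lemma exp_neg_le_inverse: "0 < u \<Longrightarrow> exp (- u) \<le> 1 / (u::real)"
  using exp_ge_add_one_self[of u] by (simp add: exp_minus divide_simps del: exp_ge_add_one_self)

lemma exp_abs_le_two_cosh: "exp \<bar>y\<bar> \<le> 2 * cosh (y::real)"
  by (simp add: cosh_def abs_if)

text \<open>
  In classical notation this is \<open>2 K\<^sub>0(2c)\<close>, with \<open>K\<^sub>0\<close> the modified Bessel function.
\<close>
definition bessel_kernel :: "complex \<Rightarrow> complex" where
  "bessel_kernel c = (\<integral>y. exp (- c * of_real (2 * cosh y)) \<partial>lborel)"

lemma norm_bessel_integrand_le: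
  assumes "Re c > 0"
  shows "norm (exp (- c * of_real (2 * cosh y))) \<le> exp (- \<bar>y\<bar>) / Re c"
proof -
  have "norm (exp (- c * of_real (2 * cosh y))) = exp (- (Re c * (2 * cosh y)))"
    by simp
  also have "\<dots> \<le> exp (- (Re c * exp \<bar>y\<bar>))"
    using assms exp_abs_le_two_cosh[of y] by simp
  also have "\<dots> \<le> 1 / (Re c * exp \<bar>y\<bar>)"
    using assms by (intro exp_neg_le_inverse) auto
  also have "\<dots> = exp (- \<bar>y\<bar>) / Re c"
    by (simp add: exp_minus field_simps)
  finally show ?thesis .
qed

lemma integrable_bessel_integrand:
  assumes "Re c > 0"
  shows "integrable lborel (\<lambda>y. exp (- c * of_real (2 * cosh y)))"
proof (rule Bochner_Integration.integrable_bound)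
  show "integrable lborel (\<lambda>y. exp (- \<bar>y\<bar>) / Re c)"
    using integrable_exp_neg_abs by simp
  have "continuous_on UNIV (\<lambda>y. exp (- c * of_real (2 * cosh y)))"
    by (intro continuous_intros)
  then show "(\<lambda>y. exp (- c * of_real (2 * cosh y))) \<in> borel_measurable lborel"
    by (simp add: borel_measurable_continuous_onI)
  show "AE y in lborel. norm (exp (- c * of_real (2 * cosh y))) \<le> norm (exp (- \<bar>y\<bar>) / Re c)"
    using norm_bessel_integrand_le[OF assms] assms by (intro AE_I2) auto
qed

lemma norm_bessel_kernel_le:
  assumes "Re c > 0"
  shows "norm (bessel_kernel c) \<le> (\<integral>y. exp (- \<bar>y\<bar>) \<partial>lborel) / Re c"
proof -
  have "norm (bessel_kernel c) \<le> (\<integral>y. exp (- \<bar>y\<bar>) / Re c \<partial>lborel)"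
    unfolding bessel_kernel_def
    using norm_bessel_integrand_le[OF assms] integrable_bessel_integrand[OF assms] integrable_exp_neg_abs
    by (intro Bochner_Integration.integral_norm_bound_integral) (auto simp del: of_real_mult)
  then show ?thesis by simp
qed

lemma two_term_exp_shift:
  assumes "m > 0" "n > 0"
  shows "m * exp (ln (n / m) / 2 + y) + n * exp (- (ln (n / m) / 2 + y)) = sqrt (m * n) * (2 * cosh (y::real))"
proof -
  define r where "r = sqrt (n / m)"
  have r: "exp (ln (n / m) / 2) = r"
    using assms by (simp add: r_def ln_sqrt[symmetric])
  have "m * r = sqrt (m * n)" "n / r = sqrt (m * n)" "r > 0"
    using assms real_sqrt_mult_self[of m] real_sqrt_mult_self[of n]
    by (simp_all add: r_def real_sqrt_divide real_sqrt_mult field_simps)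
  then have "m * (r * exp y) + n * (inverse r * exp (- y)) = sqrt (m * n) * (exp y + exp (- y))"
    by (metis divide_inverse distrib_left mult.assoc)
  then show ?thesis
    unfolding minus_add_distrib exp_add exp_minus[of "ln (n / m) / 2"] r cosh_def by simp
qed

text \<open>
  The translation of \<open>y\<close> by \<open>ln (n / m) / 2\<close> balances the two exponentials. The integral therefore
  sees \<open>m\<close> and \<open>n\<close> through their product only, which is what makes a sum over all pairs
  \<open>(m, n)\<close> collapse to a sum over \<open>m * n\<close> weighted by a Dirichlet convolution.
\<close>
lemma
  assumes "m > 0" "n > 0" "Re z > 0"
  shows integrable_two_term_exp:
      "integrable lborel (\<lambda>y. exp (- z * of_real (m * exp y + n * exp (- y))))" (is ?A)
    and integral_two_term_exp:
      "(\<integral>y. exp (- z * of_real (m * exp y + n * exp (- y))) \<partial>lborel) = bessel_kernel (z * of_real (sqrt (m * n)))" (is ?B)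
proof -
  let ?g = "\<lambda>y. exp (- z * of_real (m * exp y + n * exp (- y)))"
  let ?t = "ln (n / m) / 2"
  have eq: "?g (?t + 1 * y) = exp (- (z * of_real (sqrt (m * n))) * of_real (2 * cosh y))" for y
    using two_term_exp_shift[OF assms(1,2), of y]
    by (simp only: mult_1 mult_minus_left mult.assoc of_real_mult[symmetric])
  have "Re (z * of_real (sqrt (m * n))) > 0"
    using assms by simp
  from integrable_bessel_integrand[OF this] have "integrable lborel (\<lambda>y. ?g (?t + 1 * y))"
    unfolding eq .
  then show ?A
    using lborel_integrable_real_affine_iff[where f = ?g and c = 1 and t = ?t] by simp
  have "(\<integral>y. ?g y \<partial>lborel) = (\<integral>y. ?g (?t + 1 * y) \<partial>lborel)"
    using lborel_integral_real_affine[where f = ?g and c = 1 and t = ?t, OF one_neq_zero]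
    by (simp only: abs_one scaleR_one)
  then show ?B
    unfolding bessel_kernel_def eq .
qed

section \<open>Oscillation of the kernel\<close>

lemma cosh_le_2: "0 \<le> y \<Longrightarrow> y \<le> 1 \<Longrightarrow> cosh y \<le> (2::real)"
proof -
  assume y: "0 \<le> y" "y \<le> 1"
  have "exp y \<le> exp 1" "exp (- y) \<le> 1" "exp (1::real) \<le> 3"
    using y exp_le by simp_all
  then have "exp y + exp (- y) \<le> 4" by linarith
  then show ?thesis by (simp add: cosh_def)
qed

lemma sinh_ge_self: "0 \<le> y \<Longrightarrow> y \<le> sinh (y::real)"
proof -
  assume y: "0 \<le> y"
  have "sinh 0 - 0 \<le> sinh y - y"
  proof (rule DERIV_nonneg_imp_nondecreasing[OF y])
    fix x :: real
    show "\<exists>d. ((\<lambda>x. sinh x - x) has_real_derivative d) (at x) \<and> 0 \<le> d"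
      by (rule exI[of _ "cosh x - 1"]) (auto intro!: derivative_eq_intros cosh_real_ge_1)
  qed
  then show ?thesis by simp
qed

text \<open>
  Away from the stationary point \<open>y = 0\<close> one integrates by parts against the phase
  \<open>2 * cosh y\<close>. The amplitude produced is \<open>coth y\<close>, and because it decreases, its total variation
  is controlled by its value at the left end point, uniformly in \<open>Y\<close>.
\<close>
lemma norm_integral_cosh_exp_tail_le:
  fixes c :: complex
  assumes c: "Re c > 0" and y0: "0 < y0" "y0 \<le> 1" and Y: "1 \<le> Y"
  shows "norm (integral {y0..Y} (\<lambda>y. of_real (2 * cosh y) * exp (- c * of_real (2 * cosh y))))
           \<le> 4 / (y0 * norm c) * exp (- (2 * Re c))"
proof -
  define E where "E = (\<lambda>y::real. exp (- c * of_real (2 * cosh y)))"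
  \<comment> \<open>The derivative of \<open>G\<close> is the integrand plus an absolutely integrable error \<open>E / (c * sinh\<^sup>2)\<close>.\<close>
  define G where "G = (\<lambda>y. - (1 / c) * of_real (cosh y / sinh y) * E y)"
  have c0: "c \<noteq> 0" using c by auto
  have y0Y: "y0 \<le> Y" using y0 Y by simp
  have pos: "sinh y > 0" if "y \<in> {y0..Y}" for y using that y0 by (auto simp: sinh_real_pos_iff)
  have E: "(E has_vector_derivative (- c * of_real (2 * sinh y) * E y)) (at y within A)" for y A
  proof -
    have "((\<lambda>y. 2 * cosh y) has_real_derivative 2 * sinh y) (at y within A)"
      by (auto intro!: derivative_eq_intros)
    then have "((\<lambda>y. - c * of_real (2 * cosh y)) has_vector_derivative - c * of_real (2 * sinh y)) (at y within A)"
      by (intro has_vector_derivative_mult_right has_vector_derivative_of_real)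
         (simp add: has_real_derivative_iff_has_vector_derivative)
    from field_vector_diff_chain_within[OF this DERIV_subset[OF DERIV_exp subset_UNIV]]
    show ?thesis by (simp add: E_def o_def)
  qed
  have normE: "norm (E y) \<le> exp (- (2 * Re c))" for y
    using c cosh_real_ge_1[of y] by (simp add: E_def)
  have coth: "((\<lambda>y. cosh y / sinh y) has_real_derivative (- (1 / (sinh y)\<^sup>2))) (at y within A)"
    if "sinh y > 0" for y :: real and A
    using that cosh_square_eq[of y]
    by (auto intro!: derivative_eq_intros simp: field_simps power2_eq_square)
  have contE: "continuous_on A E" for A
    unfolding E_def by (intro continuous_intros)
  have G: "(G has_vector_derivative (of_real (2 * cosh y) * E y + (1 / c) * of_real (1 / (sinh y)\<^sup>2) * E y)) (at y within {y0..Y})"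
    if "y \<in> {y0..Y}" for y
  proof -
    have "((\<lambda>y. of_real (cosh y / sinh y) :: complex) has_vector_derivative of_real (- (1 / (sinh y)\<^sup>2))) (at y within {y0..Y})"
      using coth[OF pos[OF that]] by (intro has_vector_derivative_of_real) (simp add: has_real_derivative_iff_has_vector_derivative)
    from has_vector_derivative_mult[OF this E]
    have "((\<lambda>y. of_real (cosh y / sinh y) * E y) has_vector_derivative
            (of_real (cosh y / sinh y) * (- c * of_real (2 * sinh y) * E y)
              + of_real (- (1 / (sinh y)\<^sup>2)) * E y)) (at y within {y0..Y})"
      by simp
    from has_vector_derivative_mult_right[OF this, of "- (1 / c)"]
    show ?thesis
      unfolding G_def mult.assoc
      by (rule has_vector_derivative_eq_rhs) (use pos[OF that] c0 in \<open>simp add: field_simps\<close>)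
  qed
  have coth_int: "((\<lambda>y. 1 / (sinh y)\<^sup>2) has_integral (cosh y0 / sinh y0 - cosh Y / sinh Y)) {y0..Y}"
  proof -
    have "((\<lambda>y. 1 / (sinh y)\<^sup>2) has_integral (- (cosh Y / sinh Y) - - (cosh y0 / sinh y0))) {y0..Y}"
    proof (rule fundamental_theorem_of_calculus[OF y0Y])
      fix y assume "y \<in> {y0..Y}"
      from DERIV_minus[OF coth[OF pos[OF this]]]
      show "((\<lambda>y. - (cosh y / sinh y)) has_vector_derivative 1 / (sinh y)\<^sup>2) (at y within {y0..Y})"
        by (simp add: has_real_derivative_iff_has_vector_derivative)
    qed
    then show ?thesis by simp
  qed
  have sinh0: "sinh y \<noteq> 0" if "y \<in> {y0..Y}" for y using pos[OF that] by simp
  have int2: "(\<lambda>y. (1 / c) * of_real (1 / (sinh y)\<^sup>2) * E y) integrable_on {y0..Y}"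
    by (intro integrable_continuous_interval continuous_intros contE) (use sinh0 in auto)
  have "((\<lambda>y. of_real (2 * cosh y) * E y + (1 / c) * of_real (1 / (sinh y)\<^sup>2) * E y) has_integral (G Y - G y0)) {y0..Y}"
    by (rule fundamental_theorem_of_calculus[OF y0Y G])
  from has_integral_diff[OF this integrable_integral[OF int2]]
  have I: "integral {y0..Y} (\<lambda>y. of_real (2 * cosh y) * E y)
      = G Y - G y0 - integral {y0..Y} (\<lambda>y. (1 / c) * of_real (1 / (sinh y)\<^sup>2) * E y)"
    by (simp add: integral_unique)
  have nG: "norm (G y) \<le> 1 / norm c * exp (- (2 * Re c)) * (cosh y / sinh y)" if "y \<in> {y0..Y}" for y
  proof -
    have "norm (G y) = 1 / norm c * (cosh y / sinh y) * norm (E y)"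
      using pos[OF that] by (simp add: G_def norm_mult norm_divide)
    also have "\<dots> \<le> 1 / norm c * (cosh y / sinh y) * exp (- (2 * Re c))"
      using pos[OF that] by (intro mult_left_mono normE) auto
    finally show ?thesis by (simp add: mult_ac)
  qed
  have "norm (integral {y0..Y} (\<lambda>y. (1 / c) * of_real (1 / (sinh y)\<^sup>2) * E y))
      \<le> integral {y0..Y} (\<lambda>y. 1 / norm c * exp (- (2 * Re c)) * (1 / (sinh y)\<^sup>2))"
  proof (rule integral_norm_bound_integral[OF int2])
    show "(\<lambda>y. 1 / norm c * exp (- (2 * Re c)) * (1 / (sinh y)\<^sup>2)) integrable_on {y0..Y}"
      using coth_int by (intro integrable_on_mult_right) auto
    fix y assume "y \<in> {y0..Y}"
    have "norm ((1 / c) * of_real (1 / (sinh y)\<^sup>2) * E y) = 1 / norm c * (1 / (sinh y)\<^sup>2) * norm (E y)"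
      by (simp add: norm_mult norm_divide norm_power)
    also have "\<dots> \<le> 1 / norm c * (1 / (sinh y)\<^sup>2) * exp (- (2 * Re c))"
      by (intro mult_left_mono normE) auto
    finally show "norm ((1 / c) * of_real (1 / (sinh y)\<^sup>2) * E y)
        \<le> 1 / norm c * exp (- (2 * Re c)) * (1 / (sinh y)\<^sup>2)" by (simp add: mult_ac)
  qed
  also have "\<dots> = 1 / norm c * exp (- (2 * Re c)) * (cosh y0 / sinh y0 - cosh Y / sinh Y)"
    using coth_int by (simp only: integral_mult_right integral_unique)
  finally have n3: "norm (integral {y0..Y} (\<lambda>y. (1 / c) * of_real (1 / (sinh y)\<^sup>2) * E y)) \<le> \<dots>" .
  have alg: "k * a + k * b + k * (b - a) = k * (2 * b)" for k a b :: real
    by (simp add: algebra_simps)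
  have "norm (integral {y0..Y} (\<lambda>y. of_real (2 * cosh y) * E y))
      \<le> norm (G Y) + norm (G y0) + norm (integral {y0..Y} (\<lambda>y. (1 / c) * of_real (1 / (sinh y)\<^sup>2) * E y))"
    unfolding I by (meson norm_triangle_ineq4 order_trans add_mono order_refl)
  also have "\<dots> \<le> 1 / norm c * exp (- (2 * Re c)) * (cosh Y / sinh Y)
       + 1 / norm c * exp (- (2 * Re c)) * (cosh y0 / sinh y0)
       + 1 / norm c * exp (- (2 * Re c)) * (cosh y0 / sinh y0 - cosh Y / sinh Y)"
    using y0Y by (intro add_mono nG n3) auto
  also have "\<dots> = 1 / norm c * exp (- (2 * Re c)) * (2 * (cosh y0 / sinh y0))"
    by (rule alg)
  also have "\<dots> \<le> 1 / norm c * exp (- (2 * Re c)) * (2 * (2 / y0))"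
    using y0 pos[of y0] y0Y cosh_le_2[of y0] sinh_ge_self[of y0]
    by (intro mult_left_mono frac_le) auto
  finally show ?thesis by (simp add: E_def field_simps)
qed

text \<open>
  Up to a constant factor the integral is the derivative in \<open>c\<close> of the truncated kernel. On \<open>{0..y0}\<close> it is estimated
  trivially, beyond \<open>y0\<close> by parts. Optimising \<open>y0\<close> gives the saving \<open>norm c powr (-1/2)\<close>, which an
  estimate by absolute values loses when \<open>c\<close> approaches the imaginary axis.
\<close>
lemma norm_integral_cosh_exp_le:
  fixes c :: complex
  assumes c: "Re c > 0" and y0: "0 < y0" "y0 \<le> 1" and Y: "1 \<le> Y"
  shows "norm (integral {0..Y} (\<lambda>y. of_real (2 * cosh y) * exp (- c * of_real (2 * cosh y))))
           \<le> 4 * (y0 + 1 / (y0 * norm c)) * exp (- (2 * Re c))"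
proof -
  let ?f = "\<lambda>y::real. of_real (2 * cosh y) * exp (- c * of_real (2 * cosh y))"
  have int: "?f integrable_on {a..b}" for a b
    by (intro integrable_continuous_interval continuous_intros)
  have "norm (integral {0..y0} ?f) \<le> (4 * exp (- (2 * Re c))) * (y0 - 0)"
  proof (rule integral_bound)
    show "0 \<le> y0" using y0 by simp
    show "continuous_on {0..y0} ?f" by (intro continuous_intros)
    fix y assume "y \<in> {0..y0}"
    then have "cosh y \<le> 2" using y0 by (intro cosh_le_2) auto
    then have "2 * cosh y * exp (- (Re c * (2 * cosh y))) \<le> 4 * exp (- (2 * Re c))"
      using cosh_real_ge_1[of y] c by (intro mult_mono) auto
    then show "norm (?f y) \<le> 4 * exp (- (2 * Re c))"
      by (simp add: norm_mult)
  qed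
  moreover have "integral {0..Y} ?f = integral {0..y0} ?f + integral {y0..Y} ?f"
    using y0 Y by (intro Henstock_Kurzweil_Integration.integral_combine[symmetric] int) auto
  moreover have "norm (integral {y0..Y} ?f) \<le> 4 / (y0 * norm c) * exp (- (2 * Re c))"
    by (rule norm_integral_cosh_exp_tail_le[OF assms])
  ultimately have "norm (integral {0..Y} ?f) \<le> 4 * exp (- (2 * Re c)) * y0 + 4 / (y0 * norm c) * exp (- (2 * Re c))"
    using norm_triangle_ineq[of "integral {0..y0} ?f" "integral {y0..Y} ?f"] by simp
  then show ?thesis by (simp add: algebra_simps)
qed

text \<open>
  The truncated integrals can be differentiated in \<open>c\<close> under the integral sign; their bounds do not depend
  on the truncation and so pass to the limit.
\<close>
lemma bessel_kernel_truncation: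
  assumes "Re c > 0"
  shows "(\<lambda>n. 2 * integral {0..real n} (\<lambda>y. exp (- c * of_real (2 * cosh y)))) \<longlonglongrightarrow> bessel_kernel c"
proof -
  let ?E = "\<lambda>y::real. exp (- c * of_real (2 * cosh y))"
  have lim: "(\<lambda>n. \<integral>y. indicator {- real n..real n} y *\<^sub>R ?E y \<partial>lborel) \<longlonglongrightarrow> bessel_kernel c"
    unfolding bessel_kernel_def
  proof (rule integral_dominated_convergence[where w = "\<lambda>y. norm (?E y)"])
    show "?E \<in> borel_measurable lborel" using integrable_bessel_integrand[OF assms] by (rule borel_measurable_integrable)
    then show "(\<lambda>y. indicator {- real n..real n} y *\<^sub>R ?E y) \<in> borel_measurable lborel" for n
      by (intro borel_measurable_scaleR borel_measurable_indicator) auto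
    show "integrable lborel (\<lambda>y. norm (?E y))"
      using integrable_bessel_integrand[OF assms] by (rule integrable_norm)
    show "AE y in lborel. norm (indicator {- real n..real n} y *\<^sub>R ?E y) \<le> norm (?E y)" for n
      by (intro AE_I2) (simp split: split_indicator)
    show "AE y in lborel. (\<lambda>n. indicator {- real n..real n} y *\<^sub>R ?E y) \<longlonglongrightarrow> ?E y"
    proof (intro AE_I2 tendsto_eventually)
      fix y :: real
      obtain N :: nat where "\<bar>y\<bar> \<le> real N" using real_arch_simple by blast
      then show "\<forall>\<^sub>F n in sequentially. indicator {- real n..real n} y *\<^sub>R ?E y = ?E y"
        by (intro eventually_sequentiallyI[of N]) (auto simp: indicator_def abs_le_iff)
    qed
  qed
  have "(\<integral>y. indicator {- real n..real n} y *\<^sub>R ?E y \<partial>lborel) = 2 * integral {0..real n} ?E" for n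
  proof -
    have cont: "continuous_on A ?E" for A by (intro continuous_intros)
    have int: "?E integrable_on {a..b}" for a b
      by (rule integrable_continuous_interval[OF cont])
    have "(\<integral>y. indicator {- real n..real n} y *\<^sub>R ?E y \<partial>lborel) = integral {- real n..real n} ?E"
      using set_borel_integral_eq_integral(2)[OF borel_integrable_atLeastAtMost'[OF cont]]
      by (simp add: set_lebesgue_integral_def)
    also have "\<dots> = integral {- real n..0} ?E + integral {0..real n} ?E"
      by (intro Henstock_Kurzweil_Integration.integral_combine[symmetric] int) auto
    also have "integral {- real n..0} ?E = integral {0..real n} ?E"
      using Henstock_Kurzweil_Integration.integral_reflect_real[of "real n" 0 ?E] by simp
    finally show ?thesis by simp
  qed
  with lim show ?thesis by simp
qed

text \<open>
  Mean value inequality on the translated quadrant \<open>Re c \<ge> \<rho>, Im c \<ge> \<beta>\<close>, which is convex and on which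
  \<open>norm c \<ge> \<beta>\<close>. The parameter \<open>y0\<close> is left free, to be chosen according to the size of \<open>\<beta>\<close>.
\<close>
lemma norm_bessel_kernel_diff_le:
  assumes "\<rho> > 0" "\<beta> > 0" "0 < y0" "y0 \<le> 1"
    and c: "Re c1 \<ge> \<rho>" "Im c1 \<ge> \<beta>" "Re c2 \<ge> \<rho>" "Im c2 \<ge> \<beta>"
  shows "norm (bessel_kernel c1 - bessel_kernel c2)
           \<le> 8 * (y0 + 1 / (y0 * \<beta>)) * exp (- (2 * \<rho>)) * norm (c1 - c2)"
proof -
  define S where "S = {c. Re c \<ge> \<rho>} \<inter> {c. Im c \<ge> \<beta>}"
  have S: "convex S" unfolding S_def
    by (intro convex_Int convex_halfspace_Re_ge convex_halfspace_Im_ge)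
  define k where "k = (\<lambda>Y (c::complex). integral {0..Y} (\<lambda>y::real. exp (- c * of_real (2 * cosh y))))"
  define B where "B = 4 * (y0 + 1 / (y0 * \<beta>)) * exp (- (2 * \<rho>))"
  have bound: "norm (k Y c1 - k Y c2) \<le> B * norm (c1 - c2)" if Y: "Y \<ge> 1" for Y
  proof (rule field_differentiable_bound[OF S])
    show "c1 \<in> S" "c2 \<in> S" using c by (auto simp: S_def)
    fix c assume cS: "c \<in> S"
    have "((\<lambda>c. integral (cbox 0 Y) (\<lambda>y::real. exp (- c * of_real (2 * cosh y)))) has_field_derivative
            integral (cbox 0 Y) (\<lambda>y. - of_real (2 * cosh y) * exp (- c * of_real (2 * cosh y)))) (at c within S)"
    proof (rule leibniz_rule_field_derivative[OF _ _ _ cS S])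
      show "((\<lambda>x. exp (- x * of_real (2 * cosh t))) has_field_derivative
          - of_real (2 * cosh t) * exp (- x * of_real (2 * cosh t))) (at x within S)" for x and t :: real
        by (auto intro!: derivative_eq_intros)
      show "(\<lambda>y::real. exp (- x * of_real (2 * cosh y))) integrable_on cbox 0 Y" for x :: complex
        by (intro integrable_continuous continuous_intros)
      show "continuous_on (S \<times> cbox 0 Y) (\<lambda>(x, t::real). - of_real (2 * cosh t) * exp (- x * of_real (2 * cosh t)))"
        by (auto simp: split_beta intro!: continuous_intros)
    qed
    then show "(k Y has_field_derivative
        - integral {0..Y} (\<lambda>y. of_real (2 * cosh y) * exp (- c * of_real (2 * cosh y)))) (at c within S)"
      by (simp add: k_def)
    have c: "Re c \<ge> \<rho>" "Im c \<ge> \<beta>" using cS by (auto simp: S_def)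
    then have nc: "norm c \<ge> \<beta>" using abs_Im_le_cmod[of c] by linarith
    have "norm (integral {0..Y} (\<lambda>y. of_real (2 * cosh y) * exp (- c * of_real (2 * cosh y))))
           \<le> 4 * (y0 + 1 / (y0 * norm c)) * exp (- (2 * Re c))"
      using assms c Y by (intro norm_integral_cosh_exp_le) auto
    also have "\<dots> \<le> B" unfolding B_def
      using assms c nc
      by (intro mult_mono add_mono frac_le mult_left_mono) auto
    finally show "norm (- integral {0..Y} (\<lambda>y. of_real (2 * cosh y) * exp (- c * of_real (2 * cosh y)))) \<le> B"
      by simp
  qed
  have "(\<lambda>n. norm (2 * k (real n) c1 - 2 * k (real n) c2)) \<longlonglongrightarrow> norm (bessel_kernel c1 - bessel_kernel c2)"
    unfolding k_def using assms by (intro tendsto_norm tendsto_diff bessel_kernel_truncation) auto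
  then show ?thesis
  proof (rule tendsto_upperbound)
    show "\<forall>\<^sub>F n in sequentially. norm (2 * k (real n) c1 - 2 * k (real n) c2)
        \<le> 8 * (y0 + 1 / (y0 * \<beta>)) * exp (- (2 * \<rho>)) * norm (c1 - c2)"
    proof (rule eventually_sequentiallyI[of 1])
      fix n :: nat assume "1 \<le> n"
      then have "norm (2 * (k (real n) c1 - k (real n) c2)) \<le> 2 * (B * norm (c1 - c2))"
        unfolding norm_mult using bound[of "real n"] by simp
      moreover have "2 * (B * norm (c1 - c2)) = 8 * (y0 + 1 / (y0 * \<beta>)) * exp (- (2 * \<rho>)) * norm (c1 - c2)"
        unfolding B_def by (simp add: algebra_simps)
      ultimately show "norm (2 * k (real n) c1 - 2 * k (real n) c2)
          \<le> 8 * (y0 + 1 / (y0 * \<beta>)) * exp (- (2 * \<rho>)) * norm (c1 - c2)"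
        by (simp only: right_diff_distrib)
    qed
  qed simp
qed

section \<open>Small partial sums force a small kernel series\<close>

lemma abel_summation_nat:
  fixes a k :: "nat \<Rightarrow> 'a::comm_ring_1"
  shows "(\<Sum>n=1..N. a n * k n)
       = (\<Sum>n=1..N. (\<Sum>i=1..n. a i) * (k n - k (Suc n))) + (\<Sum>i=1..N. a i) * k (Suc N)"
  by (induction N) (simp_all add: algebra_simps)

lemma powr_nonpos_le_one: "1 \<le> x \<Longrightarrow> a \<le> 0 \<Longrightarrow> x powr a \<le> (1::real)"
  using powr_mono[of a 0 x] by simp

lemma sqrt_Suc_diff_le:
  assumes "n \<ge> 1"
  shows "sqrt (real (Suc n)) - sqrt (real n) \<le> 1 / sqrt (real n)"
proof -
  have "sqrt (real (Suc n)) \<le> sqrt (real n) + 1 / sqrt (real n)"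
    using assms by (intro real_le_lsqrt) (auto simp: power2_eq_square field_simps)
  then show ?thesis by simp
qed

text \<open>
  Each term is dominated by a difference of consecutive values of \<open>exp (- 2 * \<delta> * sqrt n) / \<delta>\<close>,
  so the sum telescopes.
\<close>
lemma sum_exp_sqrt_le:
  assumes "\<delta> > 0"
  shows "(\<Sum>n=1..N. exp (- (2 * \<delta> * sqrt (real n))) / sqrt (real n)) \<le> 1 / \<delta>"
proof -
  have step: "exp (- (2 * \<delta> * sqrt (real (Suc n)))) / sqrt (real (Suc n))
      \<le> (exp (- (2 * \<delta> * sqrt (real n))) - exp (- (2 * \<delta> * sqrt (real (Suc n))))) / \<delta>" for n
  proof -
    let ?s = "sqrt (real n)" and ?t = "sqrt (real (Suc n))"
    have t: "?t > 0" "?s \<le> ?t" by auto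
    have "?t * ?t - ?s * ?s = 1" by simp
    then have "1 = (?t - ?s) * (?t + ?s)" by (simp add: algebra_simps)
    also have "\<dots> \<le> (?t - ?s) * (2 * ?t)" using t by (intro mult_left_mono) auto
    finally have "1 / ?t \<le> 2 * (?t - ?s)" using t by (simp add: field_simps)
    then have "\<delta> / ?t \<le> 2 * \<delta> * (?t - ?s)"
      using assms mult_left_mono[of "1 / ?t" "2 * (?t - ?s)" \<delta>] by (simp add: mult_ac)
    also have "\<dots> \<le> exp (2 * \<delta> * (?t - ?s)) - 1"
      using exp_ge_add_one_self[of "2 * \<delta> * (?t - ?s)"] by linarith
    finally have "exp (- (2 * \<delta> * ?t)) * (\<delta> / ?t) \<le> exp (- (2 * \<delta> * ?t)) * (exp (2 * \<delta> * (?t - ?s)) - 1)"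
      by (intro mult_left_mono) auto
    also have "\<dots> = exp (- (2 * \<delta> * ?s)) - exp (- (2 * \<delta> * ?t))"
      by (simp add: right_diff_distrib mult_exp_exp)
    finally show ?thesis using assms t by (simp add: field_simps)
  qed
  have "(\<Sum>n=1..N. exp (- (2 * \<delta> * sqrt (real n))) / sqrt (real n))
      \<le> (1 - exp (- (2 * \<delta> * sqrt (real N)))) / \<delta>"
  proof (induction N)
    case (Suc N)
    then show ?case using step[of N] by (simp add: diff_divide_distrib)
  qed simp
  also have "\<dots> \<le> 1 / \<delta>" using assms by (intro divide_right_mono) auto
  finally show ?thesis .
qed

text \<open>
  Here \<open>\<beta>\<close> is of order \<open>sqrt n\<close>, and \<open>y0 = n powr (-1/4)\<close> balances the two terms of
  \<open>norm_bessel_kernel_diff_le\<close>. The other factor \<open>n powr (-1/2)\<close> is the size of the step from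
  \<open>sqrt n\<close> to \<open>sqrt (n + 1)\<close>.
\<close>
lemma norm_bessel_kernel_step_le:
  assumes b: "b > 0" and \<delta>: "0 < \<delta>" "\<delta> \<le> 1" and n: "n \<ge> 1"
  defines "k \<equiv> \<lambda>n. bessel_kernel (Complex \<delta> b * of_real (sqrt (real n)))"
  shows "norm (k n - k (Suc n))
           \<le> 8 * (1 + 1 / b) * (1 + b) * (exp (- (2 * \<delta> * sqrt (real n))) * real n powr (- 3 / 4))"
proof -
  define s y0 where "s = sqrt (real n)" and "y0 = real n powr (- 1 / 4)"
  have s: "s = real n powr (1/2)" "s > 0" using n by (auto simp: s_def powr_half_sqrt)
  have y0: "0 < y0" "y0 \<le> 1"
    using n by (auto simp: y0_def intro!: powr_nonpos_le_one)
  have st: "s \<le> sqrt (real (Suc n))" by (simp add: s_def)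
  have y0s: "1 / (y0 * (b * s)) = y0 / b"
  proof -
    have "y0 * y0 * s = 1"
      using n by (simp add: y0_def s flip: powr_add)
    then show ?thesis using y0 b s by (simp add: field_simps)
  qed
  have "norm (k n - k (Suc n)) \<le> 8 * (y0 + 1 / (y0 * (b * s))) * exp (- (2 * (\<delta> * s)))
      * norm (Complex \<delta> b * of_real (sqrt (real n)) - Complex \<delta> b * of_real (sqrt (real (Suc n))))"
    unfolding k_def using y0 b \<delta> s st
    by (intro norm_bessel_kernel_diff_le) (auto simp: s_def[symmetric])
  also have "norm (Complex \<delta> b * of_real (sqrt (real n)) - Complex \<delta> b * of_real (sqrt (real (Suc n))))
      = norm (Complex \<delta> b) * (sqrt (real (Suc n)) - s)"
    using st by (simp add: s_def norm_mult right_diff_distrib[symmetric] flip: of_real_diff)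
  also have "norm (Complex \<delta> b) * (sqrt (real (Suc n)) - s) \<le> (1 + b) * (1 / s)"
    using b \<delta> s st sqrt_Suc_diff_le[OF n] cmod_le[of "Complex \<delta> b"]
    by (intro mult_mono) (auto simp: s_def)
  also have "8 * (y0 + 1 / (y0 * (b * s))) * exp (- (2 * (\<delta> * s))) * ((1 + b) * (1 / s))
      = 8 * (1 + 1 / b) * (1 + b) * (exp (- (2 * \<delta> * s)) * (y0 * (1 / s)))"
    unfolding y0s by (simp add: algebra_simps add_divide_distrib)
  also have "y0 * (1 / s) = real n powr (- 3 / 4)"
    using n by (simp add: y0_def s divide_powr_uminus flip: powr_add)
  finally show ?thesis using y0 b s by (simp add: s_def mult_left_mono)
qed

text \<open>
  This is where the exponent \<open>1/4\<close> comes from: after partial summation, partial sums of size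
  \<open>\<epsilon> * n powr (1/4)\<close> meet kernel differences of size \<open>n powr (-3/4) * exp (- 2 * \<delta> * sqrt n)\<close>,
  and \<open>exp (- 2 * \<delta> * sqrt n) / sqrt n\<close> sums to at most \<open>1 / \<delta>\<close>. The initial terms, for which nothing
  is known about the partial sums, only contribute to the constant \<open>C\<close>, which is independent of \<open>\<delta>\<close>.
\<close>
lemma norm_bessel_series_le:
  fixes a :: "nat \<Rightarrow> complex"
  assumes b: "b > 0" and \<epsilon>: "\<epsilon> > 0"
    and small: "\<And>N. N \<ge> N0 \<Longrightarrow> norm (\<Sum>n=1..N. a n) \<le> \<epsilon> * real N powr (1 / 4)"
  obtains C where "\<And>\<delta> L. \<lbrakk>0 < \<delta>; \<delta> \<le> 1;
      (\<lambda>N. \<Sum>n=1..N. a n * bessel_kernel (Complex \<delta> b * of_real (sqrt (real n)))) \<longlonglongrightarrow> L\<rbrakk>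
    \<Longrightarrow> norm L \<le> C + 8 * (1 + 1 / b) * (1 + b) * \<epsilon> / \<delta>"
proof -
  define A where "A = 8 * (1 + 1 / b) * (1 + b)"
  define S where "S N = (\<Sum>n=1..N. a n)" for N
  define C where "C = (\<Sum>n<N0. norm (S n) * A)"
  define J where "J = (\<integral>y. exp (- \<bar>y\<bar>) \<partial>(lborel :: real measure))"
  have A: "A > 0" using b by (auto simp: A_def intro!: mult_pos_pos add_pos_pos)
  have J: "J \<ge> 0" by (simp add: J_def)
  have "norm L \<le> C + A * \<epsilon> / \<delta>"
    if \<delta>: "0 < \<delta>" "\<delta> \<le> 1"
      and lim: "(\<lambda>N. \<Sum>n=1..N. a n * bessel_kernel (Complex \<delta> b * of_real (sqrt (real n)))) \<longlonglongrightarrow> L" for \<delta> L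
  proof -
    define k where "k n = bessel_kernel (Complex \<delta> b * of_real (sqrt (real n)))" for n :: nat
    have step: "norm (k n - k (Suc n)) \<le> A * (exp (- (2 * \<delta> * sqrt (real n))) * real n powr (- 3 / 4))"
      if "n \<ge> 1" for n
      using norm_bessel_kernel_step_le[OF b \<delta> that] by (simp add: A_def k_def)
    have term_le: "norm (S n * (k n - k (Suc n)))
        \<le> (if n < N0 then norm (S n) * A else 0) + A * \<epsilon> * (exp (- (2 * \<delta> * sqrt (real n))) / sqrt (real n))"
      if n: "n \<ge> 1" for n
    proof (cases "n < N0")
      case True
      have "exp (- (2 * \<delta> * sqrt (real n))) * real n powr (- 3 / 4) \<le> 1 * 1"
        using n \<delta> by (intro mult_mono powr_nonpos_le_one) auto
      then have "A * (exp (- (2 * \<delta> * sqrt (real n))) * real n powr (- 3 / 4)) \<le> A * (1 * 1)"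
        using A by (intro mult_left_mono) auto
      then have "norm (k n - k (Suc n)) \<le> A"
        using step[OF n] by linarith
      then have "norm (S n * (k n - k (Suc n))) \<le> norm (S n) * A"
        by (simp add: norm_mult mult_left_mono)
      moreover have "0 \<le> A * \<epsilon> * (exp (- (2 * \<delta> * sqrt (real n))) / sqrt (real n))"
        using A \<epsilon> by simp
      ultimately show ?thesis using True by simp
    next
      case False
      have "norm (S n * (k n - k (Suc n)))
          \<le> \<epsilon> * real n powr (1 / 4) * (A * (exp (- (2 * \<delta> * sqrt (real n))) * real n powr (- 3 / 4)))"
        unfolding norm_mult using False step[OF n] small[of n] \<epsilon>
        by (intro mult_mono) (auto simp: S_def)
      also have "\<dots> = A * \<epsilon> * (exp (- (2 * \<delta> * sqrt (real n))) * (real n powr (1 / 4) * real n powr (- 3 / 4)))"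
        by (simp only: mult_ac)
      also have "real n powr (1 / 4) * real n powr (- 3 / 4) = 1 / sqrt (real n)"
      proof -
        have "real n powr (1 / 4) * real n powr (- 3 / 4) = real n powr (- (1 / 2))"
          by (simp flip: powr_add)
        also have "\<dots> = inverse (sqrt (real n))"
          by (simp only: powr_minus powr_half_sqrt of_nat_0_le_iff)
        finally show ?thesis by (simp only: inverse_eq_divide)
      qed
      finally show ?thesis using False by simp
    qed
    have main: "norm (\<Sum>n=1..N. a n * k n) \<le> C + A * \<epsilon> / \<delta> + \<epsilon> * J / \<delta> * real N powr (- 1 / 4)"
      if N: "N \<ge> max N0 1" for N
    proof -
      have "norm (\<Sum>n=1..N. S n * (k n - k (Suc n)))
          \<le> (\<Sum>n=1..N. (if n < N0 then norm (S n) * A else 0)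
               + A * \<epsilon> * (exp (- (2 * \<delta> * sqrt (real n))) / sqrt (real n)))"
        by (intro sum_norm_le term_le) auto
      also have "\<dots> = (\<Sum>n=1..N. if n < N0 then norm (S n) * A else 0)
          + A * \<epsilon> * (\<Sum>n=1..N. exp (- (2 * \<delta> * sqrt (real n))) / sqrt (real n))"
        by (simp add: sum.distrib sum_distrib_left)
      also have "\<dots> \<le> C + A * \<epsilon> * (1 / \<delta>)"
      proof (intro add_mono mult_left_mono sum_exp_sqrt_le \<delta>)
        have "(\<Sum>n=1..N. if n < N0 then norm (S n) * A else 0) = (\<Sum>n\<in>{1..N} \<inter> {..<N0}. norm (S n) * A)"
          by (simp add: sum.inter_restrict)
        also have "\<dots> \<le> C" unfolding C_def using A by (intro sum_mono2) auto
        finally show "(\<Sum>n=1..N. if n < N0 then norm (S n) * A else 0) \<le> C" .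
      qed (use A \<epsilon> in auto)
      finally have 1: "norm (\<Sum>n=1..N. S n * (k n - k (Suc n))) \<le> C + A * \<epsilon> / \<delta>" by simp
      have "norm (k (Suc N)) \<le> J / (\<delta> * sqrt (real (Suc N)))"
        using norm_bessel_kernel_le[of "Complex \<delta> b * of_real (sqrt (real (Suc N)))"] \<delta>
        by (simp add: k_def J_def)
      also have "\<dots> \<le> J / (\<delta> * sqrt (real N))"
        using \<delta> J N by (intro divide_left_mono mult_left_mono) auto
      finally have "norm (S N * k (Suc N)) \<le> \<epsilon> * real N powr (1 / 4) * (J / (\<delta> * sqrt (real N)))"
        unfolding norm_mult using small[of N] N \<epsilon> by (intro mult_mono) (auto simp: S_def)
      also have "\<dots> = \<epsilon> * J / \<delta> * (real N powr (1 / 4) / sqrt (real N))" by simp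
      also have "real N powr (1 / 4) / sqrt (real N) = real N powr (- 1 / 4)"
        using N by (simp add: powr_half_sqrt[symmetric] flip: powr_diff)
      finally have 2: "norm (S N * k (Suc N)) \<le> \<epsilon> * J / \<delta> * real N powr (- 1 / 4)" .
      have "(\<Sum>n=1..N. a n * k n) = (\<Sum>n=1..N. S n * (k n - k (Suc n))) + S N * k (Suc N)"
        unfolding S_def by (rule abel_summation_nat)
      then show ?thesis using 1 2 norm_triangle_ineq[of "\<Sum>n=1..N. S n * (k n - k (Suc n))" "S N * k (Suc N)"]
        by simp
    qed
    have "(\<lambda>N. real N powr (- 1 / 4)) \<longlonglongrightarrow> 0"
      by (rule tendsto_neg_powr) (auto intro: filterlim_real_sequentially)
    from tendsto_add[OF tendsto_const[of "C + A * \<epsilon> / \<delta>"] tendsto_mult_left[OF this, of "\<epsilon> * J / \<delta>"]]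
    have up: "(\<lambda>N. C + A * \<epsilon> / \<delta> + \<epsilon> * J / \<delta> * real N powr (- 1 / 4)) \<longlonglongrightarrow> C + A * \<epsilon> / \<delta>"
      by simp
    have "(\<lambda>N. norm (\<Sum>n=1..N. a n * k n)) \<longlonglongrightarrow> norm L"
      unfolding k_def by (intro tendsto_norm lim)
    from LIMSEQ_le[OF this up] show "norm L \<le> C + A * \<epsilon> / \<delta>"
      using main by blast
  qed
  then show ?thesis by (intro that[of C]) (auto simp: A_def)
qed

section \<open>The generating function\<close>

definition period_fun :: "nat \<Rightarrow> nat \<Rightarrow> complex" where
  "period_fun q n = (if q dvd n then 1 - of_nat q else 1)"

text \<open>
  The closed form of \<open>\<Sum>n\<ge>1. period_fun q n * exp (- n * w)\<close>. It continues the series beyond the right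
  half-plane; the poles at \<open>0\<close> of the two summands cancel because \<open>period_fun q\<close> has mean zero over a period.
\<close>
definition gen_fun :: "nat \<Rightarrow> complex \<Rightarrow> complex" where
  "gen_fun q w = 1 / (exp w - 1) - of_nat q / (exp (of_nat q * w) - 1)"

lemma norm_period_fun_le: "q \<ge> 1 \<Longrightarrow> norm (period_fun q n) \<le> real q"
proof -
  assume "q \<ge> 1"
  then have "1 - of_nat q = - (of_nat (q - 1) :: complex)" by (simp add: of_nat_diff)
  then have "norm (1 - of_nat q :: complex) = real (q - 1)" by (simp only: norm_minus_cancel norm_of_nat)
  with \<open>q \<ge> 1\<close> show ?thesis by (simp add: period_fun_def)
qed

lemma has_sum_exp_multiples:
  fixes w :: complex
  assumes "Re w > 0"
  shows "((\<lambda>n. exp (- (of_nat n * w))) has_sum (1 / (exp w - 1))) {1..}"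
proof -
  have "norm (exp (- w)) < 1" using assms by simp
  from has_sum_geometric_from_1[OF this]
  have "((\<lambda>n. exp (- (of_nat n * w))) has_sum (exp (- w) / (1 - exp (- w)))) {1..}"
    by (simp add: exp_of_nat_mult[symmetric])
  also have "exp (- w) / (1 - exp (- w)) = 1 / (exp w - 1)"
  proof -
    have "norm (exp w) > 1" using assms by simp
    then have "exp w \<noteq> 1" by (metis norm_one less_irrefl)
    then show ?thesis by (simp add: exp_minus divide_simps)
  qed
  finally show ?thesis .
qed

lemma has_sum_gen_fun:
  fixes w :: complex
  assumes w: "Re w > 0" and q: "q \<ge> 1"
  shows "((\<lambda>n. period_fun q n * exp (- (of_nat n * w))) has_sum gen_fun q w) {1..}"
proof -
  have "Re (of_nat q * w) > 0" using assms by simp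
  from has_sum_exp_multiples[OF this]
  have "((\<lambda>n. exp (- (of_nat n * w))) has_sum (1 / (exp (of_nat q * w) - 1))) {n. 1 \<le> n \<and> q dvd n}"
    by (rule has_sum_reindex_bij_witness[of _ "\<lambda>n. n div q" "\<lambda>n. q * n", THEN iffD1, rotated -1])
       (use q in \<open>auto simp: mult_ac elim!: dvdE\<close>)
  then have "((\<lambda>n. if q dvd n then exp (- (of_nat n * w)) else 0) has_sum (1 / (exp (of_nat q * w) - 1))) {1..}"
    by (rule has_sum_cong_neutral[THEN iffD1, rotated -1]) auto
  from has_sum_add[OF has_sum_exp_multiples[OF w] has_sum_cmult_right[OF this, of "- of_nat q"]]
  have "((\<lambda>n. exp (- (of_nat n * w)) + - of_nat q * (if q dvd n then exp (- (of_nat n * w)) else 0))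
      has_sum gen_fun q w) {1..}"
    by (simp add: gen_fun_def)
  also have "?this \<longleftrightarrow> ?thesis"
    by (intro has_sum_cong) (simp add: period_fun_def algebra_simps)
  finally show ?thesis .
qed

definition hyperbola_region :: "nat \<Rightarrow> (nat \<times> nat) set" where
  "hyperbola_region N = {(m, n). 1 \<le> m \<and> 1 \<le> n \<and> m * n \<le> N}"

lemma hyperbola_region_subset: "hyperbola_region N \<subseteq> {1..N} \<times> {1..N}"
proof safe
  fix m n assume "(m, n) \<in> hyperbola_region N"
  then have h: "1 \<le> m" "1 \<le> n" "m * n \<le> N" by (auto simp: hyperbola_region_def)
  have "m * 1 \<le> m * n" "1 * n \<le> m * n" using h by (intro mult_le_mono; simp)+
  then have "m \<le> N" "n \<le> N" using h(3) by linarith+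
  then show "m \<in> {1..N}" "n \<in> {1..N}" using h by auto
qed

lemma finite_hyperbola_region: "finite (hyperbola_region N)"
  using hyperbola_region_subset by (rule finite_subset) simp

lemma sum_divisors_eq_sum_hyperbola:
  "(\<Sum>n=1..N. \<Sum>d | d dvd n. g d (n div d)) = (\<Sum>(m, n)\<in>hyperbola_region N. g m n)"
proof -
  have "(\<Sum>n=1..N. \<Sum>d | d dvd n. g d (n div d))
      = (\<Sum>(n, d)\<in>(SIGMA n:{1..N}. {d. d dvd n}). g d (n div d))"
    by (intro sum.Sigma) auto
  also have "\<dots> = (\<Sum>(m, n)\<in>hyperbola_region N. g m n)"
    by (rule sum.reindex_bij_witness[of _ "\<lambda>(m, n). (m * n, m)" "\<lambda>(n, d). (d, n div d)"])
       (auto simp: hyperbola_region_def elim!: dvdE)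
  finally show ?thesis .
qed

text \<open>
  The regions below the hyperbolas are finite and exhaust the quadrant, so they compute any unconditional sum over it.
\<close>
lemma hyperbola_sums_tendsto:
  assumes "(g has_sum L) ({1..} \<times> {1..})"
  shows "(\<lambda>N. sum g (hyperbola_region N)) \<longlonglongrightarrow> L"
proof (rule filterlim_compose[OF assms[unfolded has_sum_def]])
  show "filterlim hyperbola_region (finite_subsets_at_top ({1..} \<times> {1..})) sequentially"
    unfolding filterlim_finite_subsets_at_top
  proof safe
    fix X :: "(nat \<times> nat) set" assume X: "finite X" "X \<subseteq> {1..} \<times> {1..}"
    define M where "M = (\<Sum>(m, n)\<in>X. m * n)"
    have "X \<subseteq> hyperbola_region N" if N: "M \<le> N" for N
    proof safe
      fix m n assume mn: "(m, n) \<in> X"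
      then have "m * n \<le> M"
        unfolding M_def using member_le_sum[of "(m, n)" X "\<lambda>(m, n). m * n"] X by auto
      then show "(m, n) \<in> hyperbola_region N" using mn X N by (auto simp: hyperbola_region_def)
    qed
    then show "\<forall>\<^sub>F N in sequentially. finite (hyperbola_region N) \<and> X \<subseteq> hyperbola_region N
        \<and> hyperbola_region N \<subseteq> {1..} \<times> {1..}"
      by (intro eventually_sequentiallyI[of M])
         (use hyperbola_region_subset in \<open>fastforce simp: finite_hyperbola_region\<close>)
  qed
qed

lemma has_sum_times_complex:
  fixes f g :: "nat \<Rightarrow> complex"
  assumes f: "(f has_sum a) A" and g: "(g has_sum b) B"
  shows "((\<lambda>(m, n). f m * g n) has_sum (a * b)) (A \<times> B)"
proof (rule has_sum_SigmaI)
  show "((\<lambda>n. case (m, n) of (m, n) \<Rightarrow> f m * g n) has_sum f m * b) B" for m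
    using has_sum_cmult_right[OF g, of "f m"] by simp
  show "((\<lambda>m. f m * b) has_sum a * b) A"
    by (rule has_sum_cmult_left[OF f])
  have fa: "(\<lambda>m. norm (f m)) summable_on A" and ga: "(\<lambda>n. norm (g n)) summable_on B"
    using f g by (auto dest!: has_sum_imp_summable simp: summable_on_iff_abs_summable_on_complex)
  have "(\<lambda>p. norm (case p of (m, n) \<Rightarrow> f m * g n)) summable_on A \<times> B"
  proof (rule summable_on_SigmaI)
    show "((\<lambda>n. norm (case (m, n) of (m, n) \<Rightarrow> f m * g n)) has_sum norm (f m) * (\<Sum>\<^sub>\<infinity>n\<in>B. norm (g n))) B" for m
      using has_sum_cmult_right[OF has_sum_infsum[OF ga], of "norm (f m)"] by (simp add: norm_mult)
    show "(\<lambda>m. norm (f m) * (\<Sum>\<^sub>\<infinity>n\<in>B. norm (g n))) summable_on A"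
      by (rule summable_on_cmult_left[OF fa])
  qed auto
  then show "(\<lambda>(m, n). f m * g n) summable_on A \<times> B"
    by (rule abs_summable_summable)
qed

lemma sum_exp_le:
  assumes "r > 0"
  shows "(\<Sum>n=1..N. exp (- (real n * r))) \<le> 1 / (exp r - 1)"
proof -
  have "((\<lambda>n. exp (- (of_nat n * complex_of_real r))) has_sum (1 / (exp (complex_of_real r) - 1))) {1..}"
    using assms by (intro has_sum_exp_multiples) simp
  then have "((\<lambda>n. complex_of_real (exp (- (real n * r)))) has_sum complex_of_real (1 / (exp r - 1))) {1..}"
    by (simp flip: exp_of_real)
  then have "((\<lambda>n. exp (- (real n * r))) has_sum (1 / (exp r - 1))) {1..}"
    by (simp only: has_sum_of_real_iff)
  then show ?thesis by (rule finite_sum_le_has_sum) auto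
qed

lemma inverse_exp_minus_one_le:
  assumes "r > (0::real)"
  shows "1 / (exp r - 1) \<le> 1 / r" "1 / (exp r - 1) \<le> 2 / r\<^sup>2"
proof -
  have q: "1 + r + r\<^sup>2 / 2 \<le> exp r" using assms by (intro exp_lower_Taylor_quadratic) auto
  have r2: "r\<^sup>2 > 0" using assms by simp
  show "1 / (exp r - 1) \<le> 1 / r" using exp_ge_add_one_self[of r] assms by (intro frac_le) linarith+
  have "1 / (exp r - 1) \<le> 1 / (r\<^sup>2 / 2)" using q r2 assms by (intro frac_le) auto
  then show "1 / (exp r - 1) \<le> 2 / r\<^sup>2" by simp
qed

text \<open>
  The dominating function for the sum under the integral. The quadratic bound is spent on the factor whose
  exponent grows, so that the product decays at both ends of the line.
\<close>
lemma inverse_exp_minus_one_product_le: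
  fixes \<delta> y :: real
  assumes "\<delta> > 0"
  shows "1 / (exp (\<delta> * exp y) - 1) * (1 / (exp (\<delta> * exp (- y)) - 1)) \<le> 2 / \<delta> ^ 3 * exp (- \<bar>y\<bar>)"
proof -
  have *: "1 / (exp (\<delta> * exp y) - 1) * (1 / (exp (\<delta> * exp (- y)) - 1)) \<le> 2 / \<delta> ^ 3 * exp (- y)" for y :: real
  proof -
    have "1 / (exp (\<delta> * exp y) - 1) * (1 / (exp (\<delta> * exp (- y)) - 1))
        \<le> 2 / (\<delta> * exp y)\<^sup>2 * (1 / (\<delta> * exp (- y)))"
      using assms by (intro mult_mono inverse_exp_minus_one_le) auto
    also have "\<dots> = 2 / \<delta> ^ 3 * exp (- y)"
      using assms by (simp add: exp_minus field_simps power2_eq_square power3_eq_cube)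
    finally show ?thesis .
  qed
  show ?thesis using *[of y] *[of "- y"] by (cases "y \<ge> 0") (simp_all add: mult.commute)
qed

definition gen_product :: "nat \<Rightarrow> complex \<Rightarrow> real \<Rightarrow> complex" where
  "gen_product q z y = gen_fun q (z * of_real (exp y)) * gen_fun q (z * of_real (exp (- y)))"

text \<open>
  Multiplying out the two series for \<open>gen_fun\<close> gives a sum over pairs \<open>(m, n)\<close>; integrated over \<open>y\<close>,
  each term depends on \<open>m * n\<close> only. Summation below hyperbolas and dominated convergence turn this into
  the series of the convolution against the kernel.
\<close>
lemma
  assumes q: "q \<ge> 1" and z: "Re z > 0"
  shows bessel_series_tendsto:
      "(\<lambda>N. \<Sum>n=1..N. dirichlet_conv (period_fun q) (period_fun q) n * bessel_kernel (z * of_real (sqrt (real n))))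
         \<longlonglongrightarrow> (\<integral>y. gen_product q z y \<partial>lborel)"
    and integrable_gen_product: "integrable lborel (gen_product q z)"
proof -
  define f where "f = period_fun q"
  define E where "E = (\<lambda>m n y. exp (- z * of_real (real m * exp y + real n * exp (- y))))"
  define F where "F = (\<lambda>N y. \<Sum>(m, n)\<in>hyperbola_region N. f m * f n * E m n y)"
  let ?G = "gen_product q z"
  let ?w = "\<lambda>y. (real q)\<^sup>2 * (2 / Re z ^ 3 * exp (- \<bar>y\<bar>))"
  have pos: "m > 0" "n > 0" if "(m, n) \<in> hyperbola_region N" for m n N
    using that by (auto simp: hyperbola_region_def)
  have intE: "integrable lborel (E m n)" if "m > 0" "n > 0" for m n
    using integrable_two_term_exp[of "real m" "real n" z] that z by (simp add: E_def)
  have meas: "E m n \<in> borel_measurable lborel" for m n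
  proof -
    have "continuous_on UNIV (E m n)" unfolding E_def by (intro continuous_intros)
    then show ?thesis by (simp add: borel_measurable_continuous_onI)
  qed
  have Fint: "integral\<^sup>L lborel (F N)
      = (\<Sum>n=1..N. dirichlet_conv f f n * bessel_kernel (z * of_real (sqrt (real n))))" for N
  proof -
    have "integral\<^sup>L lborel (F N) = (\<Sum>(m, n)\<in>hyperbola_region N. f m * f n * integral\<^sup>L lborel (E m n))"
      unfolding F_def split_beta
      by (subst Bochner_Integration.integral_sum) (auto intro!: Bochner_Integration.integrable_mult_right intE dest: pos)
    also have "\<dots> = (\<Sum>(m, n)\<in>hyperbola_region N. f m * f n * bessel_kernel (z * of_real (sqrt (real (m * n)))))"
    proof (intro sum.cong refl, clarify)
      fix m n assume "(m, n) \<in> hyperbola_region N"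
      from pos[OF this] show "f m * f n * integral\<^sup>L lborel (E m n)
          = f m * f n * bessel_kernel (z * of_real (sqrt (real (m * n))))"
        using integral_two_term_exp[of "real m" "real n" z] z by (simp add: E_def)
    qed
    also have "\<dots> = (\<Sum>n=1..N. \<Sum>d | d dvd n. f d * f (n div d) * bessel_kernel (z * of_real (sqrt (real (d * (n div d))))))"
      by (rule sum_divisors_eq_sum_hyperbola[symmetric])
    also have "\<dots> = (\<Sum>n=1..N. dirichlet_conv f f n * bessel_kernel (z * of_real (sqrt (real n))))"
      by (simp add: dirichlet_conv_def sum_distrib_right)
    finally show ?thesis .
  qed
  have lim: "(\<lambda>N. F N y) \<longlonglongrightarrow> ?G y" for y
  proof -
    have "((\<lambda>(m, n). f m * exp (- (of_nat m * (z * of_real (exp y)))) * (f n * exp (- (of_nat n * (z * of_real (exp (- y)))))))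
        has_sum ?G y) ({1..} \<times> {1..})"
      unfolding f_def gen_product_def using z q by (intro has_sum_times_complex has_sum_gen_fun) auto
    moreover have "E m n y = exp (- (of_nat m * (z * of_real (exp y)))) * exp (- (of_nat n * (z * of_real (exp (- y)))))" for m n
      by (simp add: E_def mult_exp_exp algebra_simps)
    ultimately have "((\<lambda>(m, n). f m * f n * E m n y) has_sum ?G y) ({1..} \<times> {1..})"
      by (simp add: mult_ac)
    from hyperbola_sums_tendsto[OF this] show ?thesis by (simp add: F_def)
  qed
  have bound: "norm (F N y) \<le> ?w y" for N y
  proof -
    let ?r = "Re z * exp y" and ?s = "Re z * exp (- y)"
    have "norm (F N y) \<le> (\<Sum>(m, n)\<in>hyperbola_region N. (real q)\<^sup>2 * (exp (- (real m * ?r)) * exp (- (real n * ?s))))"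
      unfolding F_def split_beta
    proof (rule sum_norm_le)
      fix p assume "p \<in> hyperbola_region N"
      have "norm (E (fst p) (snd p) y) = exp (- (real (fst p) * ?r)) * exp (- (real (snd p) * ?s))"
        by (simp add: E_def mult_exp_exp algebra_simps)
      moreover have "norm (f (fst p) * f (snd p)) \<le> (real q)\<^sup>2"
        unfolding norm_mult power2_eq_square f_def using q by (intro mult_mono norm_period_fun_le) auto
      ultimately show "norm (f (fst p) * f (snd p) * E (fst p) (snd p) y)
          \<le> (real q)\<^sup>2 * (exp (- (real (fst p) * ?r)) * exp (- (real (snd p) * ?s)))"
        by (simp add: norm_mult[of "f (fst p) * f (snd p)"] mult_right_mono)
    qed
    also have "\<dots> \<le> (\<Sum>(m, n)\<in>{1..N} \<times> {1..N}. (real q)\<^sup>2 * (exp (- (real m * ?r)) * exp (- (real n * ?s))))"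
      by (intro sum_mono2 hyperbola_region_subset) (auto simp: split_beta)
    also have "\<dots> = (real q)\<^sup>2 * ((\<Sum>m=1..N. exp (- (real m * ?r))) * (\<Sum>n=1..N. exp (- (real n * ?s))))"
      by (subst sum_product) (simp only: sum_distrib_left sum.cartesian_product, simp add: split_beta)
    also have "\<dots> \<le> (real q)\<^sup>2 * (1 / (exp ?r - 1) * (1 / (exp ?s - 1)))"
      using z by (intro mult_left_mono mult_mono sum_exp_le) (auto intro: sum_nonneg)
    also have "\<dots> \<le> ?w y"
      using z by (intro mult_left_mono inverse_exp_minus_one_product_le) auto
    finally show ?thesis .
  qed
  have w: "integrable lborel ?w"
    using integrable_exp_neg_abs by simp
  have Fmeas: "F N \<in> borel_measurable lborel" for N
    unfolding F_def split_beta by (intro borel_measurable_sum borel_measurable_times borel_measurable_const meas)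
  have Gmeas: "?G \<in> borel_measurable lborel"
    using lim Fmeas by (rule borel_measurable_LIMSEQ_metric[rotated])
  have "(\<lambda>N. integral\<^sup>L lborel (F N)) \<longlonglongrightarrow> integral\<^sup>L lborel ?G"
    by (rule integral_dominated_convergence[OF Gmeas Fmeas w]) (use lim bound in auto)
  then show "(\<lambda>N. \<Sum>n=1..N. dirichlet_conv (period_fun q) (period_fun q) n * bessel_kernel (z * of_real (sqrt (real n))))
          \<longlonglongrightarrow> integral\<^sup>L lborel ?G"
    by (simp only: Fint f_def)
  show "integrable lborel ?G"
    by (rule integrable_dominated_convergence[where s = F, OF Gmeas Fmeas w]) (use lim bound in auto)
qed

section \<open>The generating function near its first pole\<close>

lemma norm_inverse_exp_minus_one_le:
  fixes w :: complex
  assumes "Re w > 0"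
  shows "norm (1 / (exp w - 1)) \<le> 1 / Re w"
proof -
  have "Re w \<le> exp (Re w) - 1" using exp_ge_add_one_self[of "Re w"] by linarith
  also have "\<dots> \<le> norm (exp w - 1)" using norm_triangle_ineq2[of "exp w" 1] by simp
  finally show ?thesis unfolding norm_divide norm_one using assms by (intro frac_le) auto
qed

lemma norm_gen_fun_le:
  assumes "Re w > 0" "q \<ge> 1"
  shows "norm (gen_fun q w) \<le> 2 / Re w"
proof -
  have "norm (of_nat q * (1 / (exp (of_nat q * w) - 1))) \<le> real q * (1 / Re (of_nat q * w))"
    unfolding norm_mult norm_of_nat using assms by (intro mult_left_mono norm_inverse_exp_minus_one_le) auto
  also have "\<dots> = 1 / Re w" using assms by simp
  finally have "norm (of_nat q / (exp (of_nat q * w) - 1)) \<le> 1 / Re w" by simp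
  with norm_inverse_exp_minus_one_le[OF assms(1)] show ?thesis
    unfolding gen_fun_def
    using norm_triangle_ineq4[of "1 / (exp w - 1)" "of_nat q / (exp (of_nat q * w) - 1)"] by simp
qed

lemma norm_inverse_exp_minus_pole_le:
  fixes u :: complex
  assumes "u \<noteq> 0" "norm u \<le> 1 / 4"
  shows "norm (1 / (exp u - 1) - 1 / u) \<le> 4"
proof -
  have "norm (exp u - (\<Sum>k\<le>1. u ^ k / fact k)) \<le> exp \<bar>Re u\<bar> * norm u ^ Suc 1 / fact 1"
    by (rule Taylor_exp)
  also have "\<dots> \<le> 2 * norm u ^ 2"
  proof -
    have "\<bar>Re u\<bar> \<le> 1/2" using abs_Re_le_cmod[of u] assms by simp
    then have "exp \<bar>Re u\<bar> \<le> 2" using exp_bound_half[of "\<bar>Re u\<bar>"] by simp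
    then show ?thesis by (simp add: power2_eq_square mult_right_mono)
  qed
  finally have 1: "norm (exp u - 1 - u) \<le> 2 * norm u ^ 2" by (simp add: algebra_simps)
  also have "\<dots> \<le> norm u / 2"
    using assms mult_right_mono[of "norm u" "1/4" "norm u"] by (simp add: power2_eq_square)
  finally have "norm (exp u - 1) \<ge> norm u / 2"
    using norm_triangle_ineq3[of "exp u - 1" u] by linarith
  then have 2: "norm ((exp u - 1) * u) \<ge> norm u ^ 2 / 2" and nz: "exp u - 1 \<noteq> 0"
    using assms by (auto simp: norm_mult power2_eq_square mult_right_mono)
  have "1 / (exp u - 1) - 1 / u = - (exp u - 1 - u) / ((exp u - 1) * u)"
    using nz assms by (simp add: field_simps)
  then have "norm (1 / (exp u - 1) - 1 / u) = norm (exp u - 1 - u) / norm ((exp u - 1) * u)"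
    by (simp only: norm_divide norm_minus_cancel)
  also have "\<dots> \<le> (2 * norm u ^ 2) / (norm u ^ 2 / 2)"
    using assms 1 2 by (intro frac_le) auto
  also have "\<dots> = 4" using assms by simp
  finally show ?thesis .
qed

text \<open>
  The leading term of \<open>gen_product q (Complex \<delta> b)\<close> near \<open>y = 0\<close>, for \<open>b = 2 * pi / q\<close>: both factors of the product have a simple
  pole with residue \<open>-1\<close> at \<open>Complex 0 b\<close>, and the two signs cancel.
\<close>
definition pole_part :: "real \<Rightarrow> real \<Rightarrow> real \<Rightarrow> real \<Rightarrow> complex" where
  "pole_part b \<eta> \<delta> y = (if \<bar>y\<bar> \<le> \<eta> then
     1 / ((Complex \<delta> b * of_real (exp y) - Complex 0 b) * (Complex \<delta> b * of_real (exp (- y)) - Complex 0 b)) else 0)"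

context
  fixes q :: nat and b :: real and w0 :: complex
  assumes q: "q \<ge> 2"
  defines "b \<equiv> 2 * pi / real q" and "w0 \<equiv> Complex 0 b"
begin

lemma b_pos: "b > 0" using q by (simp add: b_def)

lemma q_w0: "of_nat q * w0 = 2 * of_real pi * \<i>"
  using q by (simp add: w0_def b_def complex_eq_iff)

lemma exp_w0_multiple_ne_one:
  assumes "s \<notin> \<int>"
  shows "exp (of_nat q * (w0 * of_real s)) \<noteq> 1" "exp (w0 * of_real s) \<noteq> 1"
proof -
  show 1: "exp (of_nat q * (w0 * of_real s)) \<noteq> 1"
  proof
    assume "exp (of_nat q * (w0 * of_real s)) = 1"
    then have "exp (2 * of_real pi * \<i> * of_real s) = 1" by (simp only: mult.assoc[symmetric] q_w0)
    then obtain n :: int where "2 * pi * s = of_int (2 * n) * pi" by (auto simp: exp_eq_1)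
    then have "s = of_int n" by simp
    with assms show False by simp
  qed
  then show "exp (w0 * of_real s) \<noteq> 1" by (auto simp: exp_of_nat_mult)
qed

text \<open>
  At \<open>w0 = 2 * pi * \<i> / q\<close> only the second summand of \<open>gen_fun\<close> is singular, and there
  \<open>exp (q * w) = exp (q * (w - w0))\<close> reduces its pole to the one of \<open>1 / (exp u - 1)\<close> at \<open>u = 0\<close>.
\<close>
lemma gen_fun_pole_bounded:
  obtains r C where "r > 0" "\<And>w. \<lbrakk>norm (w - w0) < r; w \<noteq> w0\<rbrakk> \<Longrightarrow> norm (gen_fun q w + 1 / (w - w0)) \<le> C"
proof -
  have "exp w0 \<noteq> 1"
  proof
    assume "exp w0 = 1"
    then obtain n :: int where "b = of_int (2 * n) * pi" by (auto simp: exp_eq_1 w0_def)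
    then have "1 = of_int n * real q" using q by (simp add: b_def field_simps)
    then have "1 = n * int q" by (metis of_int_1 of_int_eq_iff of_int_mult of_int_of_nat_eq)
    then have "int q dvd 1" by (metis dvd_triv_right)
    then show False using q by simp
  qed
  then have "isCont (\<lambda>w. 1 / (exp w - 1)) w0" by (intro continuous_intros) auto
  then obtain r1 where r1: "r1 > 0" "\<And>w. dist w w0 < r1 \<Longrightarrow> dist (1 / (exp w - 1)) (1 / (exp w0 - 1)) < 1"
    unfolding continuous_at_eps_delta by (metis zero_less_one)
  show ?thesis
  proof (rule that[of "min r1 (1 / (4 * real q))" "norm (1 / (exp w0 - 1)) + 1 + real q * 4"])
    show "min r1 (1 / (4 * real q)) > 0" using q r1 by simp
    fix w assume w: "norm (w - w0) < min r1 (1 / (4 * real q))" "w \<noteq> w0"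
    define u where "u = of_nat q * (w - w0)"
    have "norm u = real q * norm (w - w0)" by (simp only: u_def norm_mult norm_of_nat)
    then have u: "u \<noteq> 0" "norm u \<le> 1 / 4" using w q by (auto simp: u_def field_simps)
    have "exp (of_nat q * w) = exp (u + of_nat q * w0)" by (simp add: u_def algebra_simps)
    also have "\<dots> = exp u" by (simp add: q_w0 exp_add)
    finally have e: "exp (of_nat q * w) = exp u" .
    have "gen_fun q w + 1 / (w - w0) = 1 / (exp w - 1) - of_nat q * (1 / (exp u - 1) - 1 / u)"
      using q w unfolding gen_fun_def e by (simp add: u_def field_simps)
    moreover have "norm (1 / (exp w - 1)) \<le> norm (1 / (exp w0 - 1)) + 1"
      using r1(2)[of w] w norm_triangle_ineq2[of "1 / (exp w - 1)" "1 / (exp w0 - 1)"]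
      by (simp add: dist_norm)
    moreover have "norm (of_nat q * (1 / (exp u - 1) - 1 / u)) \<le> real q * 4"
      unfolding norm_mult norm_of_nat using norm_inverse_exp_minus_pole_le[OF u] by (intro mult_left_mono) auto
    ultimately show "norm (gen_fun q w + 1 / (w - w0)) \<le> norm (1 / (exp w0 - 1)) + 1 + real q * 4"
      using norm_triangle_ineq4[of "1 / (exp w - 1)" "of_nat q * (1 / (exp u - 1) - 1 / u)"] by simp
  qed
qed

text \<open>
  The segment from \<open>0\<close> to \<open>w0\<close>, cut off before \<open>w0\<close>, contains no pole. Compactness covers the
  points away from \<open>0\<close>; near \<open>0\<close> the closed form has cancelling poles, which are subtracted by hand.
\<close>
lemma gen_fun_bounded_below_pole:
  assumes "\<eta> > 0"
  obtains C where "\<And>\<delta> s. \<lbrakk>0 < \<delta>; \<delta> \<le> 1; 0 < s; s \<le> exp (- \<eta>)\<rbrakk>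
      \<Longrightarrow> norm (gen_fun q (Complex \<delta> b * of_real s)) \<le> C"
proof -
  \<comment> \<open>For \<open>s \<le> s1\<close> one has \<open>norm (q * w) \<le> 1 / 4\<close>, the range of \<open>norm_inverse_exp_minus_pole_le\<close>.\<close>
  define s1 where "s1 = 1 / (4 * real q * (1 + b))"
  define T where "T = {0..1::real} \<times> {s1..exp (- \<eta>)}"
  define h where "h = (\<lambda>(\<delta>, s). gen_fun q (Complex \<delta> b * of_real s))"
  have s1: "s1 > 0" using q b_pos by (simp add: s1_def)
  have nz: "exp (of_nat q * (Complex \<delta> b * of_real s)) \<noteq> 1"
    if "s > 0" "s \<le> exp (- \<eta>)" "\<delta> \<ge> 0" for \<delta> s
  proof (cases "\<delta> = 0")
    case True
    have "exp (- \<eta>) < 1" using assms by simp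
    then have "s < 1" using that by linarith
    have "s \<notin> \<int>"
    proof
      assume "s \<in> \<int>"
      then obtain n :: int where "s = of_int n" by (auto elim: Ints_cases)
      with \<open>s > 0\<close> \<open>s < 1\<close> show False by simp
    qed
    from exp_w0_multiple_ne_one(1)[OF this] show ?thesis using True by (simp add: w0_def)
  next
    case False
    then have "norm (exp (of_nat q * (Complex \<delta> b * of_real s))) > 1" using that q by simp
    then show ?thesis by (metis norm_one less_irrefl)
  qed
  have nz': "exp (Complex \<delta> b * of_real s) \<noteq> 1"
    if "s > 0" "s \<le> exp (- \<eta>)" "\<delta> \<ge> 0" for \<delta> s
    using nz[OF that] by (auto simp: exp_of_nat_mult)
  have "continuous_on T h"
    unfolding h_def gen_fun_def split_beta Complex_eq T_def
    using nz nz' s1 by (intro continuous_intros) (auto simp: Complex_eq)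
  moreover have "compact T" unfolding T_def by (intro compact_Times compact_Icc)
  ultimately have "bounded (h ` T)" by (intro compact_imp_bounded compact_continuous_image)
  then obtain C where C: "\<And>p. p \<in> T \<Longrightarrow> norm (h p) \<le> C" by (auto simp: bounded_iff)
  show ?thesis
  proof (rule that[of "max C (4 + real q * 4)"])
    fix \<delta> s :: real assume a: "0 < \<delta>" "\<delta> \<le> 1" "0 < s" "s \<le> exp (- \<eta>)"
    define w where "w = Complex \<delta> b * of_real s"
    show "norm (gen_fun q (Complex \<delta> b * of_real s)) \<le> max C (4 + real q * 4)"
    proof (cases "s1 \<le> s")
      case True
      then show ?thesis using C[of "(\<delta>, s)"] a by (auto simp: T_def h_def)
    next
      case False
      have "norm (Complex \<delta> b) \<le> 1 + b" using cmod_le[of "Complex \<delta> b"] a b_pos by simp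
      then have "norm w \<le> (1 + b) * s1"
        unfolding w_def norm_mult using False a b_pos by (intro mult_mono) auto
      also have "\<dots> = 1 / (4 * real q)" using b_pos by (simp add: s1_def)
      finally have nw: "norm w \<le> 1 / (4 * real q)" .
      have w0: "w \<noteq> 0" using a by (auto simp: w_def complex_eq_iff)
      have u: "of_nat q * w \<noteq> 0" "norm (of_nat q * w) \<le> 1 / 4"
        using w0 q nw by (auto simp: norm_mult field_simps)
      have "1 / (4 * real q) \<le> 1 / 4" using q by (simp add: field_simps)
      then have w4: "norm w \<le> 1 / 4" using nw by linarith
      have "gen_fun q w = (1 / (exp w - 1) - 1 / w) - of_nat q * (1 / (exp (of_nat q * w) - 1) - 1 / (of_nat q * w))"
        using w0 q unfolding gen_fun_def by (simp add: right_diff_distrib)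
      also have "norm \<dots> \<le> 4 + real q * 4"
        by (rule order.trans[OF norm_triangle_ineq4])
           (auto simp: norm_mult intro!: add_mono mult_left_mono
              norm_inverse_exp_minus_pole_le[OF w0 w4] norm_inverse_exp_minus_pole_le[OF u, unfolded norm_mult])
      finally show ?thesis by (simp add: w_def)
    qed
  qed
qed

section \<open>Growth of the integral at the pinched poles\<close>

lemma kernel_pole_factor:
  "(Complex \<delta> b * of_real (exp y) - w0) * (Complex \<delta> b * of_real (exp (- y)) - w0)
     = Complex (\<delta>\<^sup>2 + b\<^sup>2 * (2 * cosh y - 2)) (- (\<delta> * b * (2 * cosh y - 2)))"
proof -
  have e: "exp y * exp (- y) = 1" by (simp add: mult_exp_exp)
  have "\<delta> * exp y * (\<delta> * exp (- y)) - b * (exp y - 1) * (b * (exp (- y) - 1))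
      = \<delta>\<^sup>2 * (exp y * exp (- y)) + b\<^sup>2 * (exp y + exp (- y) - 1 - exp y * exp (- y))"
    by (simp add: algebra_simps power2_eq_square)
  moreover have "\<delta> * exp y * (b * (exp (- y) - 1)) + b * (exp y - 1) * (\<delta> * exp (- y))
      = - (\<delta> * b * (exp y + exp (- y) - 2 * (exp y * exp (- y))))"
    by (simp add: algebra_simps)
  ultimately show ?thesis
    unfolding e by (simp add: complex_eq_iff w0_def cosh_def algebra_simps)
qed

lemma cosh_minus_one_le:
  assumes "\<bar>y\<bar> \<le> (1::real)"
  shows "2 * cosh y - 2 \<le> 2 * y\<^sup>2"
proof -
  have *: "2 * cosh y - 2 \<le> 2 * y\<^sup>2" if y: "0 \<le> y" "y \<le> 1" for y :: real
  proof -
    have "exp y \<le> 1 + y + y\<^sup>2" using y by (intro exp_bound) auto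
    moreover have "exp (- y) \<le> 1 - y + y\<^sup>2"
    proof -
      have "1 \<le> (1 - y + y\<^sup>2) * (1 + y)"
        using y by (simp add: algebra_simps power2_eq_square)
      also have "\<dots> \<le> (1 - y + y\<^sup>2) * exp y"
        using y exp_ge_add_one_self[of y] by (intro mult_left_mono) auto
      finally show ?thesis by (simp add: exp_minus field_simps)
    qed
    moreover have "2 * cosh y = exp y + exp (- y)" by (simp add: cosh_def)
    ultimately show ?thesis by linarith
  qed
  show ?thesis using *[of y] *[of "- y"] assms by (cases "y \<ge> 0") auto
qed

text \<open>
  For \<open>\<delta> \<le> b\<close> the denominator lies in the sector \<open>\<bar>Im D\<bar> \<le> Re D\<close>, so its inverse has positive real
  part and no cancellation occurs in the integral of \<open>pole_part\<close>. At distance at most \<open>\<delta>\<close> from \<open>0\<close> the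
  denominator has size \<open>\<delta>\<^sup>2\<close>.
\<close>
lemma Re_inverse_pole_factor:
  fixes \<delta> y :: real
  defines "D \<equiv> Complex (\<delta>\<^sup>2 + b\<^sup>2 * (2 * cosh y - 2)) (- (\<delta> * b * (2 * cosh y - 2)))"
  assumes d: "0 < \<delta>" "\<delta> \<le> b"
  shows "0 \<le> Re (1 / D)" "\<bar>y\<bar> \<le> \<delta> \<Longrightarrow> \<delta> \<le> 1 \<Longrightarrow> 1 / (2 * \<delta>\<^sup>2 * (1 + 2 * b\<^sup>2)) \<le> Re (1 / D)"
proof -
  define k where "k = 2 * cosh y - 2"
  define X Y where "X = \<delta>\<^sup>2 + b\<^sup>2 * k" and "Y = - (\<delta> * b * k)"
  have k: "k \<ge> 0" using cosh_real_ge_1[of y] by (simp add: k_def)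
  have X: "X > 0" using k d by (auto simp: X_def intro: add_pos_nonneg)
  have "\<bar>Y\<bar> = \<delta> * (b * k)" using k d b_pos by (simp add: Y_def abs_mult)
  also have "\<dots> \<le> b * (b * k)" using k d b_pos by (intro mult_right_mono) auto
  also have "\<dots> \<le> X" by (simp add: X_def power2_eq_square)
  finally have "Y\<^sup>2 \<le> X\<^sup>2" using X by (simp add: abs_le_square_iff[symmetric])
  then have "X / (2 * X\<^sup>2) \<le> X / (X\<^sup>2 + Y\<^sup>2)"
    using X by (intro divide_left_mono mult_pos_pos add_pos_nonneg) auto
  moreover have "Re (1 / D) = X / (X\<^sup>2 + Y\<^sup>2)"
    by (simp add: D_def X_def Y_def k_def Re_divide)
  ultimately have lower: "1 / (2 * X) \<le> Re (1 / D)"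
    using X by (simp add: power2_eq_square)
  moreover have "0 \<le> 1 / (2 * X)" using X by simp
  ultimately show "0 \<le> Re (1 / D)" by linarith
  assume y: "\<bar>y\<bar> \<le> \<delta>" "\<delta> \<le> 1"
  have "k \<le> 2 * y\<^sup>2" unfolding k_def using y by (intro cosh_minus_one_le) auto
  also have "\<dots> \<le> 2 * \<delta>\<^sup>2" using y d by (simp add: abs_le_square_iff[symmetric])
  finally have "b\<^sup>2 * k \<le> b\<^sup>2 * (2 * \<delta>\<^sup>2)" by (intro mult_left_mono) auto
  then have "X \<le> \<delta>\<^sup>2 * (1 + 2 * b\<^sup>2)" by (simp add: X_def algebra_simps)
  then have "1 / (2 * \<delta>\<^sup>2 * (1 + 2 * b\<^sup>2)) \<le> 1 / (2 * X)"
    using X by (intro frac_le) auto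
  then show "1 / (2 * \<delta>\<^sup>2 * (1 + 2 * b\<^sup>2)) \<le> Re (1 / D)" using lower by linarith
qed

lemma integrable_gen_product_vertical: "\<delta> > 0 \<Longrightarrow> integrable lborel (gen_product q (Complex \<delta> b))"
  using q by (intro integrable_gen_product) auto

lemma pole_part_measurable: "pole_part b \<eta> \<delta> \<in> borel_measurable lborel"
proof -
  have "(\<lambda>y. Complex \<delta> b * of_real (exp (c * y)) - w0) \<in> borel_measurable borel" for c
    by (intro borel_measurable_continuous_onI continuous_intros)
  from this[of 1] this[of "-1"] have [measurable]:
    "(\<lambda>y. Complex \<delta> b * of_real (exp y) - w0) \<in> borel_measurable borel"
    "(\<lambda>y. Complex \<delta> b * of_real (exp (- y)) - w0) \<in> borel_measurable borel" by auto
  show ?thesis unfolding pole_part_def[abs_def] w0_def[symmetric] by measurable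
qed

text \<open>
  An interval of length \<open>2 * \<delta>\<close> on which the integrand is of size \<open>1 / \<delta>\<^sup>2\<close> already contributes \<open>1 / \<delta>\<close>.
\<close>
lemma pole_part_lower_bound:
  assumes "integrable lborel (pole_part b \<eta> \<delta>)" "0 < \<delta>" "\<delta> \<le> b" "\<delta> \<le> 1" "\<delta> \<le> \<eta>"
  shows "1 / (1 + 2 * b\<^sup>2) \<le> \<delta> * Re (\<integral>y. pole_part b \<eta> \<delta> y \<partial>lborel)"
proof -
  let ?c = "1 / (2 * \<delta>\<^sup>2 * (1 + 2 * b\<^sup>2))"
  have "2 * \<delta> * ?c = (\<integral>y. indicator {- \<delta>..\<delta>} y *\<^sub>R ?c \<partial>lborel)"
    using assms by simp
  also have "\<dots> \<le> (\<integral>y. Re (pole_part b \<eta> \<delta> y) \<partial>lborel)"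
  proof (rule integral_mono)
    show "integrable lborel (\<lambda>y. indicator {- \<delta>..\<delta>} y *\<^sub>R ?c)"
      by (intro integrable_scaleR_left integrable_real_indicator) (auto simp: emeasure_lborel_Icc_eq)
    show "integrable lborel (\<lambda>y. Re (pole_part b \<eta> \<delta> y))" using assms by simp
    fix y :: real
    show "indicator {- \<delta>..\<delta>} y *\<^sub>R ?c \<le> Re (pole_part b \<eta> \<delta> y)"
    proof (cases "\<bar>y\<bar> \<le> \<delta>")
      case True
      then have "y \<in> {- \<delta>..\<delta>}" by auto
      with True Re_inverse_pole_factor(2)[of \<delta> y] assms show ?thesis
        by (auto simp: pole_part_def w0_def[symmetric] kernel_pole_factor)
    next
      case False
      then have "y \<notin> {- \<delta>..\<delta>}" by auto
      with Re_inverse_pole_factor(1)[of \<delta> y] assms show ?thesis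
        by (auto simp: pole_part_def w0_def[symmetric] kernel_pole_factor)
    qed
  qed
  also have "\<dots> = Re (\<integral>y. pole_part b \<eta> \<delta> y \<partial>lborel)" using assms by simp
  finally have "\<delta> * (2 * \<delta> * ?c) \<le> \<delta> * Re (\<integral>y. pole_part b \<eta> \<delta> y \<partial>lborel)"
    using assms by (intro mult_left_mono) auto
  also have "\<delta> * (2 * \<delta> * ?c) = 1 / (1 + 2 * b\<^sup>2)"
    using assms by (simp add: power2_eq_square)
  finally show ?thesis .
qed

text \<open>
  A majorant, independent of \<open>\<delta>\<close>, for \<open>\<delta>\<close> times everything but the leading term. For
  \<open>\<bar>y\<bar> > \<eta>\<close> one factor of the product stays on the segment below the pole and is bounded, while the other is
  at most \<open>2 / (\<delta> * exp \<bar>y\<bar>)\<close>. For \<open>\<bar>y\<bar> \<le> \<eta>\<close> both are a pole term plus a bounded term \<open>Q\<close>; the product of the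
  pole terms is \<open>pole_part\<close>, and the mixed products contain one pole term only, which is \<open>O(1 / \<delta>)\<close>.
\<close>
lemma remainder_bound:
  obtains \<eta> \<delta>0 K where "\<eta> > 0" "\<delta>0 > 0" "\<delta>0 \<le> 1"
    "\<And>\<delta> y. \<lbrakk>0 < \<delta>; \<delta> \<le> \<delta>0\<rbrakk> \<Longrightarrow>
       norm (of_real \<delta> * (gen_product q (Complex \<delta> b) y - pole_part b \<eta> \<delta> y)) \<le> K * exp (- \<bar>y\<bar>)"
proof -
  obtain r C2 where r: "r > 0" and C2: "\<And>w. \<lbrakk>norm (w - w0) < r; w \<noteq> w0\<rbrakk> \<Longrightarrow> norm (gen_fun q w + 1 / (w - w0)) \<le> C2"
    by (rule gen_fun_pole_bounded) blast
  \<comment> \<open>With these choices both arguments of the product stay within distance \<open>r\<close> of the pole when \<open>\<bar>y\<bar> \<le> \<eta>\<close>.\<close>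
  define \<eta> where "\<eta> = min 1 (r / (8 * b))"
  define \<delta>0 where "\<delta>0 = min 1 (r / 8)"
  have \<eta>: "\<eta> > 0" "\<eta> \<le> 1" "2 * b * \<eta> \<le> r / 4"
    using r b_pos min.cobounded2[of 1 "r / (8 * b)"] by (auto simp: \<eta>_def field_simps min_def)
  have \<delta>0: "\<delta>0 > 0" "\<delta>0 \<le> 1" "\<delta>0 \<le> r / 8" using r by (auto simp: \<delta>0_def)
  obtain C3 where C3: "\<And>\<delta> s. \<lbrakk>0 < \<delta>; \<delta> \<le> 1; 0 < s; s \<le> exp (- \<eta>)\<rbrakk>
      \<Longrightarrow> norm (gen_fun q (Complex \<delta> b * of_real s)) \<le> C3"
    using gen_fun_bounded_below_pole[OF \<eta>(1)] by metis
  have C3_nonneg: "C3 \<ge> 0" using order.trans[OF norm_ge_zero C3[of 1 "exp (- \<eta>)"]] by simp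
  have C2_nonneg: "C2 \<ge> 0"
    using order.trans[OF norm_ge_zero C2[of "w0 + of_real (r / 2)"]] r by simp
  define K where "K = 2 * C3 + (2 * (3 * C2) + C2\<^sup>2) * 3"
  define Q where "Q w = gen_fun q w + 1 / (w - w0)" for w
  have near: "norm (Complex \<delta> b * of_real (exp y) - w0) < r" "norm (Q (Complex \<delta> b * of_real (exp y))) \<le> C2"
      "norm (of_real \<delta> * (1 / (Complex \<delta> b * of_real (exp y) - w0))) \<le> 3"
    if d: "0 < \<delta>" "\<delta> \<le> \<delta>0" and y: "\<bar>y\<bar> \<le> \<eta>" for \<delta> y
  proof -
    have y1: "\<bar>y\<bar> \<le> 1" using y \<eta> by linarith
    have "exp y \<le> exp 1" using y1 by simp
    then have e3: "exp y \<le> 3" using exp_le by linarith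
    have "\<bar>exp y - 1\<bar> \<le> 2 * \<bar>y\<bar>"
    proof (cases "y \<ge> 0")
      case True
      have "exp y \<le> 1 + y + y\<^sup>2" using True y1 by (intro exp_bound) auto
      also have "y\<^sup>2 \<le> y" using True y1 mult_left_mono[of y 1 y] by (simp add: power2_eq_square)
      finally show ?thesis using True by simp
    next
      case False
      then have "1 - exp y \<le> - (2 * y)" using exp_ge_add_one_self[of y] by linarith
      moreover have "exp y \<le> 1" using False by simp
      ultimately show ?thesis using False by (simp add: abs_if)
    qed
    also have "\<dots> \<le> 2 * \<eta>" using y by simp
    finally have "b * \<bar>exp y - 1\<bar> \<le> b * (2 * \<eta>)" using b_pos by (intro mult_left_mono) auto
    also have "\<dots> \<le> r / 4" using \<eta> by simp
    finally have im: "b * \<bar>exp y - 1\<bar> \<le> r / 4" .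
    have "\<delta> * exp y \<le> (r / 8) * 3" using d \<delta>0 e3 r by (intro mult_mono) auto
    moreover have eq: "Complex \<delta> b * of_real (exp y) - w0 = Complex (\<delta> * exp y) (b * (exp y - 1))"
      by (simp add: complex_eq_iff w0_def algebra_simps)
    ultimately show lt: "norm (Complex \<delta> b * of_real (exp y) - w0) < r"
      unfolding eq using cmod_le[of "Complex (\<delta> * exp y) (b * (exp y - 1))"] im d r b_pos
      by (simp add: abs_mult)
    have ge: "\<delta> * exp y \<le> norm (Complex \<delta> b * of_real (exp y) - w0)"
      unfolding eq using complex_Re_le_cmod[of "Complex (\<delta> * exp y) (b * (exp y - 1))"] by simp
    moreover have "\<delta> * exp y > 0" using d by simp
    ultimately have "Complex \<delta> b * of_real (exp y) \<noteq> w0" by auto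
    with lt C2 show "norm (Q (Complex \<delta> b * of_real (exp y))) \<le> C2" unfolding Q_def by blast
    have "norm (of_real \<delta> * (1 / (Complex \<delta> b * of_real (exp y) - w0))) \<le> \<delta> * (1 / (\<delta> * exp y))"
      unfolding norm_mult norm_divide norm_one using d ge by (intro mult_mono frac_le) auto
    also have "\<dots> = exp (- y)" using d by (simp add: exp_minus field_simps)
    also have "\<dots> \<le> exp 1" using y1 by simp
    also have "\<dots> \<le> 3" using exp_le .
    finally show "norm (of_real \<delta> * (1 / (Complex \<delta> b * of_real (exp y) - w0))) \<le> 3" .
  qed
  have far: "norm (of_real \<delta> * gen_product q (Complex \<delta> b) y) \<le> 2 * C3 * exp (- y)"
    if d: "0 < \<delta>" "\<delta> \<le> \<delta>0" and y: "\<eta> < y" for \<delta> y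
  proof -
    have "norm (gen_fun q (Complex \<delta> b * of_real (exp y))) \<le> 2 / Re (Complex \<delta> b * of_real (exp y))"
      using d q by (intro norm_gen_fun_le) auto
    then have "norm (gen_fun q (Complex \<delta> b * of_real (exp y))) \<le> 2 / (\<delta> * exp y)" by simp
    moreover have "norm (gen_fun q (Complex \<delta> b * of_real (exp (- y)))) \<le> C3"
      using d \<delta>0 y by (intro C3) auto
    ultimately have "norm (of_real \<delta> * gen_product q (Complex \<delta> b) y) \<le> \<delta> * (2 / (\<delta> * exp y) * C3)"
      unfolding gen_product_def norm_mult using d by (intro mult_mono) auto
    also have "\<dots> = 2 * C3 * exp (- y)" using d by (simp add: exp_minus field_simps)
    finally show ?thesis .
  qed
  have sym: "gen_product q (Complex \<delta> b) (- y) = gen_product q (Complex \<delta> b) y" for \<delta> y by (simp add: gen_product_def mult.commute)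
  show ?thesis
  proof (rule that[OF \<eta>(1) \<delta>0(1,2), of K])
    fix \<delta> y :: real assume d: "0 < \<delta>" "\<delta> \<le> \<delta>0"
    show "norm (of_real \<delta> * (gen_product q (Complex \<delta> b) y - pole_part b \<eta> \<delta> y)) \<le> K * exp (- \<bar>y\<bar>)"
    proof (cases "\<bar>y\<bar> \<le> \<eta>")
      case False
      then have "norm (of_real \<delta> * gen_product q (Complex \<delta> b) y) \<le> 2 * C3 * exp (- \<bar>y\<bar>)"
        using far[OF d, of y] far[OF d, of "- y"] sym by (cases "y \<ge> 0") auto
      also have "\<dots> \<le> K * exp (- \<bar>y\<bar>)"
        using C2_nonneg by (intro mult_right_mono) (auto simp: K_def)
      finally show ?thesis using False by (simp add: pole_part_def)
    next
      case True
      define A B where "A = 1 / (Complex \<delta> b * of_real (exp y) - w0)"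
        and "B = 1 / (Complex \<delta> b * of_real (exp (- y)) - w0)"
      define Q1 Q2 where "Q1 = Q (Complex \<delta> b * of_real (exp y))" and "Q2 = Q (Complex \<delta> b * of_real (exp (- y)))"
      have n: "norm Q1 \<le> C2" "norm Q2 \<le> C2" "norm (of_real \<delta> * A) \<le> 3" "norm (of_real \<delta> * B) \<le> 3"
        using near[OF d, of y] near[OF d, of "- y"] True by (auto simp: Q1_def Q2_def A_def B_def)
      have eq: "of_real \<delta> * (gen_product q (Complex \<delta> b) y - pole_part b \<eta> \<delta> y)
          = of_real \<delta> * (Q1 * Q2) - (of_real \<delta> * A) * Q2 - Q1 * (of_real \<delta> * B)"
      proof -
        have e: "gen_product q (Complex \<delta> b) y = (Q1 - A) * (Q2 - B)" "pole_part b \<eta> \<delta> y = A * B"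
          using True by (simp_all add: gen_product_def pole_part_def w0_def[symmetric] Q1_def Q2_def A_def B_def Q_def)
        show ?thesis unfolding e by (simp add: algebra_simps)
      qed
      have "norm (of_real \<delta> * (Q1 * Q2)) \<le> 1 * (C2 * C2)"
        unfolding norm_mult using n d \<delta>0 C2_nonneg by (intro mult_mono) auto
      moreover have "norm ((of_real \<delta> * A) * Q2) \<le> 3 * C2"
        unfolding norm_mult[of "_ * _"] using n by (intro mult_mono) auto
      moreover have "norm (Q1 * (of_real \<delta> * B)) \<le> C2 * 3"
        unfolding norm_mult[of Q1] using n C2_nonneg by (intro mult_mono) auto
      ultimately have "norm (of_real \<delta> * (gen_product q (Complex \<delta> b) y - pole_part b \<eta> \<delta> y)) \<le> 2 * (3 * C2) + C2\<^sup>2"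
        unfolding eq power2_eq_square
        using norm_triangle_ineq4[of "of_real \<delta> * (Q1 * Q2) - (of_real \<delta> * A) * Q2" "Q1 * (of_real \<delta> * B)"]
          norm_triangle_ineq4[of "of_real \<delta> * (Q1 * Q2)" "(of_real \<delta> * A) * Q2"] by linarith
      also have "\<dots> \<le> (2 * (3 * C2) + C2\<^sup>2) * (3 * exp (- \<bar>y\<bar>))"
      proof -
        have "\<bar>y\<bar> \<le> 1" using True \<eta> by linarith
        then have "exp \<bar>y\<bar> \<le> exp 1" by simp
        then have "exp \<bar>y\<bar> \<le> 3" using exp_le by linarith
        then have "1 \<le> 3 * exp (- \<bar>y\<bar>)" by (simp add: exp_minus field_simps)
        from mult_left_mono[OF this, of "2 * (3 * C2) + C2\<^sup>2"] show ?thesis using C2_nonneg by simp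
      qed
      also have "\<dots> \<le> K * exp (- \<bar>y\<bar>)"
        using C3_nonneg by (simp add: K_def algebra_simps)
      finally show ?thesis .
    qed
  qed
qed

text \<open>
  As \<open>\<delta>\<close> tends to \<open>0\<close> the line approaches the imaginary axis, where the generating function has further
  poles. They are met only if \<open>exp y\<close> or \<open>exp (- y)\<close> is an integer, a null set of \<open>y\<close>; elsewhere
  both terms converge, and the factor \<open>\<delta>\<close> makes the limit zero.
\<close>
lemma remainder_tendsto_zero:
  assumes \<delta>: "\<delta> \<longlonglongrightarrow> 0" and y: "exp y \<notin> \<int>" "exp (- y) \<notin> \<int>"
  shows "(\<lambda>n. of_real (\<delta> n) * (gen_product q (Complex (\<delta> n) b) y - pole_part b \<eta> (\<delta> n) y)) \<longlonglongrightarrow> 0"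
proof -
  have z: "(\<lambda>n. Complex (\<delta> n) b * of_real t) \<longlonglongrightarrow> w0 * of_real t" for t
    unfolding w0_def Complex_eq by (intro tendsto_intros) (use \<delta> in simp_all)
  have g: "(\<lambda>n. gen_fun q (Complex (\<delta> n) b * of_real t)) \<longlonglongrightarrow> gen_fun q (w0 * of_real t)" if "t \<notin> \<int>" for t
    unfolding gen_fun_def using exp_w0_multiple_ne_one[OF that] by (intro tendsto_intros z) auto
  have i: "(\<lambda>n. gen_product q (Complex (\<delta> n) b) y) \<longlonglongrightarrow> gen_fun q (w0 * of_real (exp y)) * gen_fun q (w0 * of_real (exp (- y)))"
    unfolding gen_product_def by (intro tendsto_mult g y)
  have nz: "w0 * of_real t - w0 \<noteq> 0" if "t \<notin> \<int>" for t
    using that b_pos by (auto simp: w0_def complex_eq_iff)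
  have p: "\<exists>L. (\<lambda>n. pole_part b \<eta> (\<delta> n) y) \<longlonglongrightarrow> L"
  proof (cases "\<bar>y\<bar> \<le> \<eta>")
    case True
    have "(\<lambda>n. 1 / ((Complex (\<delta> n) b * of_real (exp y) - w0) * (Complex (\<delta> n) b * of_real (exp (- y)) - w0)))
        \<longlonglongrightarrow> 1 / ((w0 * of_real (exp y) - w0) * (w0 * of_real (exp (- y)) - w0))"
      using nz[OF y(1)] nz[OF y(2)] by (intro tendsto_intros z) auto
    then show ?thesis using True by (auto simp: pole_part_def w0_def[symmetric])
  qed (auto simp: pole_part_def)
  then obtain L where L: "(\<lambda>n. pole_part b \<eta> (\<delta> n) y) \<longlonglongrightarrow> L" ..
  from tendsto_mult[OF tendsto_of_real[OF \<delta>] tendsto_diff[OF i L]] show ?thesis by simp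
qed

lemma AE_exp_not_Ints: "AE y in lborel. exp (y::real) \<notin> \<int> \<and> exp (- y) \<notin> \<int>"
proof -
  have "{y::real. exp y \<in> \<int> \<or> exp (- y) \<in> \<int>} \<subseteq> ln ` \<int> \<union> (\<lambda>t. - ln t) ` \<int>"
  proof
    fix y :: real assume "y \<in> {y. exp y \<in> \<int> \<or> exp (- y) \<in> \<int>}"
    moreover have "y = ln (exp y)" "y = - ln (exp (- y))" by simp_all
    ultimately show "y \<in> ln ` \<int> \<union> (\<lambda>t. - ln t) ` \<int>" by blast
  qed
  moreover have "countable (\<int> :: real set)" unfolding Ints_def by auto
  ultimately have "countable {y::real. exp y \<in> \<int> \<or> exp (- y) \<in> \<int>}"
    by (meson countable_Un countable_image countable_subset)
  then have "{y::real. exp y \<in> \<int> \<or> exp (- y) \<in> \<int>} \<in> null_sets lborel"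
    by (rule countable_imp_null_set_lborel)
  from AE_not_in[OF this] show ?thesis by eventually_elim auto
qed

text \<open>
  By dominated convergence the remainder contributes \<open>o(1 / \<delta>)\<close>, so the integral inherits at least half
  of the lower bound for the leading term.
\<close>
lemma gen_product_integral_lower_bound:
  assumes \<delta>: "\<And>n. \<delta> n > 0" "\<delta> \<longlonglongrightarrow> 0"
  shows "\<forall>\<^sub>F n in sequentially. 1 / (2 * (1 + 2 * b\<^sup>2)) \<le> \<delta> n * norm (\<integral>y. gen_product q (Complex (\<delta> n) b) y \<partial>lborel)"
proof -
  obtain \<eta> \<delta>0 K where *: "\<eta> > 0" "\<delta>0 > 0" "\<delta>0 \<le> 1"
    and bound: "\<And>\<delta> y. \<lbrakk>0 < \<delta>; \<delta> \<le> \<delta>0\<rbrakk> \<Longrightarrow>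
       norm (of_real \<delta> * (gen_product q (Complex \<delta> b) y - pole_part b \<eta> \<delta> y)) \<le> K * exp (- \<bar>y\<bar>)"
    by (rule remainder_bound) blast
  define d where "d = min (min \<delta>0 b) \<eta>"
  have d: "d > 0" "d \<le> \<delta>0" "d \<le> b" "d \<le> \<eta>" using * b_pos by (auto simp: d_def)
  define R where "R n y = of_real (\<delta> n) * (gen_product q (Complex (\<delta> n) b) y - pole_part b \<eta> (\<delta> n) y)" for n y
  obtain N where N: "\<And>n. n \<ge> N \<Longrightarrow> \<delta> n < d"
    using order_tendstoD(2)[OF \<delta>(2) d(1)] by (auto simp: eventually_sequentially)
  have w: "integrable lborel (\<lambda>y. K * exp (- \<bar>y\<bar>))" using integrable_exp_neg_abs by simp
  have meas: "R n \<in> borel_measurable lborel" for n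
    unfolding R_def[abs_def]
    using borel_measurable_integrable[OF integrable_gen_product_vertical[OF \<delta>(1)]] pole_part_measurable
    by (intro borel_measurable_times borel_measurable_diff borel_measurable_const)
  have bd: "norm (R n y) \<le> K * exp (- \<bar>y\<bar>)" if "n \<ge> N" for n y
    unfolding R_def using N[OF that] d \<delta>(1)[of n] by (intro bound) auto
  have intR: "integrable lborel (R n)" if "n \<ge> N" for n
    by (rule Bochner_Integration.integrable_bound[OF w meas])
       (use order.trans[OF bd[OF that] abs_ge_self] in auto)
  have intP: "integrable lborel (pole_part b \<eta> (\<delta> n))" if "n \<ge> N" for n
  proof -
    have "integrable lborel (\<lambda>y. gen_product q (Complex (\<delta> n) b) y - of_real (1 / \<delta> n) * R n y)"
      using intR[OF that] integrable_gen_product_vertical[OF \<delta>(1)] by simp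
    moreover have "gen_product q (Complex (\<delta> n) b) y - of_real (1 / \<delta> n) * R n y = pole_part b \<eta> (\<delta> n) y" for y
      using \<delta>(1)[of n] by (simp add: R_def)
    ultimately show ?thesis by simp
  qed
  have "(\<lambda>n. \<integral>y. R (n + N) y \<partial>lborel) \<longlonglongrightarrow> (\<integral>y. 0 \<partial>(lborel :: real measure))"
  proof (rule integral_dominated_convergence[OF _ meas w])
    show "AE y in lborel. (\<lambda>n. R (n + N) y) \<longlonglongrightarrow> 0"
      using AE_exp_not_Ints
    proof eventually_elim
      case (elim y)
      have "(\<lambda>n. \<delta> (n + N)) \<longlonglongrightarrow> 0" using \<delta>(2) by (rule LIMSEQ_ignore_initial_segment)
      from remainder_tendsto_zero[OF this] elim show ?case by (simp add: R_def)
    qed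
    show "AE y in lborel. norm (R (n + N) y) \<le> K * exp (- \<bar>y\<bar>)" for n
      using bd by (intro AE_I2) auto
  qed simp
  then have "(\<lambda>n. \<integral>y. R n y \<partial>lborel) \<longlonglongrightarrow> 0" by (simp add: LIMSEQ_offset)
  then have "(\<lambda>n. norm (\<integral>y. R n y \<partial>lborel)) \<longlonglongrightarrow> 0" by (rule tendsto_norm_zero)
  moreover have "0 < 1 / (2 * (1 + 2 * b\<^sup>2))" by (simp add: add_pos_nonneg)
  ultimately have "\<forall>\<^sub>F n in sequentially. norm (\<integral>y. R n y \<partial>lborel) < 1 / (2 * (1 + 2 * b\<^sup>2))"
    by (rule order_tendstoD(2))
  then show ?thesis using eventually_ge_at_top[of N]
  proof eventually_elim
    case (elim n)
    have "(\<integral>y. R n y \<partial>lborel) = of_real (\<delta> n) * ((\<integral>y. gen_product q (Complex (\<delta> n) b) y \<partial>lborel) - (\<integral>y. pole_part b \<eta> (\<delta> n) y \<partial>lborel))"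
      unfolding R_def using intP[OF elim(2)] integrable_gen_product_vertical[OF \<delta>(1)] by simp
    then have eq: "of_real (\<delta> n) * (\<integral>y. gen_product q (Complex (\<delta> n) b) y \<partial>lborel)
        = of_real (\<delta> n) * (\<integral>y. pole_part b \<eta> (\<delta> n) y \<partial>lborel) + (\<integral>y. R n y \<partial>lborel)"
      by (simp add: algebra_simps)
    have "1 / (1 + 2 * b\<^sup>2) \<le> \<delta> n * Re (\<integral>y. pole_part b \<eta> (\<delta> n) y \<partial>lborel)"
      using intP[OF elim(2)] \<delta>(1)[of n] N[OF elim(2)] d * by (intro pole_part_lower_bound) auto
    also have "\<dots> = Re (of_real (\<delta> n) * (\<integral>y. pole_part b \<eta> (\<delta> n) y \<partial>lborel))" by simp
    also have "\<dots> = Re (of_real (\<delta> n) * (\<integral>y. gen_product q (Complex (\<delta> n) b) y \<partial>lborel)) - Re (\<integral>y. R n y \<partial>lborel)"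
      unfolding eq by simp
    also have "\<dots> \<le> norm (of_real (\<delta> n) * (\<integral>y. gen_product q (Complex (\<delta> n) b) y \<partial>lborel)) + norm (\<integral>y. R n y \<partial>lborel)"
      using complex_Re_le_cmod[of "of_real (\<delta> n) * (\<integral>y. gen_product q (Complex (\<delta> n) b) y \<partial>lborel)"]
        abs_Re_le_cmod[of "\<integral>y. R n y \<partial>lborel"] by linarith
    also have "norm (of_real (\<delta> n) * (\<integral>y. gen_product q (Complex (\<delta> n) b) y \<partial>lborel)) = \<delta> n * norm (\<integral>y. gen_product q (Complex (\<delta> n) b) y \<partial>lborel)"
      using \<delta>(1)[of n] by (simp add: norm_mult)
    finally have "1 / (1 + 2 * b\<^sup>2) \<le> \<delta> n * norm (\<integral>y. gen_product q (Complex (\<delta> n) b) y \<partial>lborel) + norm (\<integral>y. R n y \<partial>lborel)" .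
    moreover have "1 / s = 2 * (1 / (2 * s))" for s :: real by simp
    from this[of "1 + 2 * b\<^sup>2"] have "1 / (1 + 2 * b\<^sup>2) = 2 * (1 / (2 * (1 + 2 * b\<^sup>2)))" .
    moreover have "h \<le> u" if "2 * h \<le> u + v" "v < h" for h u v :: real
      using that by linarith
    ultimately show ?case using elim(1) by metis
  qed
qed

end

section \<open>Admissible functions and the conclusion\<close>

lemma summatory_of_nat: "summatory f (real N) = (\<Sum>n=1..N. f n)"
  unfolding summatory_def by (rule sum.cong) auto

lemma sum_period_fun:
  assumes "q \<ge> 1"
  shows "(\<Sum>n=1..N. period_fun q n) = of_nat (N mod q)"
proof (induction N)
  case (Suc N)
  show ?case
  proof (cases "Suc (N mod q) = q")
    case True
    then have "q dvd Suc N" "of_nat q = (of_nat (N mod q) + 1 :: complex)"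
      by (simp_all add: dvd_eq_mod_eq_0 mod_Suc) (metis of_nat_Suc add.commute)
    with Suc show ?thesis by (simp add: period_fun_def)
  next
    case False
    then have "Suc N mod q = Suc (N mod q)" "\<not> q dvd Suc N" by (simp_all add: dvd_eq_mod_eq_0 mod_Suc)
    with Suc show ?thesis by (simp add: period_fun_def)
  qed
qed simp

lemma admissible_period_fun:
  assumes q: "prime q"
  shows "admissible q (period_fun q)"
proof -
  have q1: "q \<ge> 1" "q \<ge> 2" using prime_ge_2_nat[OF q] by auto
  have "multiplicative_arith (period_fun q)"
    unfolding multiplicative_arith_def
  proof (intro conjI allI impI)
    show "period_fun q 1 = 1" using q1 by (simp add: period_fun_def)
    fix n m :: nat assume "coprime n m"
    then have "\<not> (q dvd n \<and> q dvd m)"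
      using coprime_common_divisor[of n m q] q1 by auto
    then show "period_fun q (n * m) = period_fun q n * period_fun q m"
      by (auto simp: period_fun_def prime_dvd_mult_iff[OF q])
  qed
  moreover have "periodic_arith q (period_fun q)"
    by (simp add: periodic_arith_def period_fun_def)
  moreover have "bounded_partial_sums (period_fun q)"
    unfolding bounded_partial_sums_def
  proof (intro exI[of _ "real q"] conjI allI impI)
    fix x :: real assume "x \<ge> 1"
    have "summatory (period_fun q) x = (\<Sum>n=1..nat \<lfloor>x\<rfloor>. period_fun q n)"
      unfolding summatory_def using \<open>x \<ge> 1\<close> by (intro sum.cong) (auto simp: le_nat_iff le_floor_iff)
    then have "norm (summatory (period_fun q) x) = real (nat \<lfloor>x\<rfloor> mod q)"
      using sum_period_fun[OF q1(1)] by simp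
    also have "\<dots> \<le> real q" using q1 by (simp add: less_imp_le)
    finally show "norm (summatory (period_fun q) x) \<le> real q" .
  qed (use q1 in simp)
  moreover have "period_fun q q \<noteq> 0"
    using q1 by (simp add: period_fun_def)
  ultimately show ?thesis by (simp add: admissible_def)
qed

text \<open>
  Periodicity gives \<open>g (q * m) = g q\<close> for all \<open>m\<close>. If \<open>m\<close> is prime to \<open>q\<close>, the left side is also
  \<open>g q * g m\<close>, and \<open>g q \<noteq> 0\<close> yields \<open>g m = 1\<close>. Bounded partial sums now force the sum over a period
  to vanish, which determines \<open>g q\<close>.
\<close>
lemma admissible_unique:
  assumes q: "prime q" and g: "admissible q g" and n: "n \<ge> 1"
  shows "g n = period_fun q n"
proof -
  have q2: "q \<ge> 2" using prime_ge_2_nat[OF q] .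
  have per: "g (m + k * q) = g m" if "m \<ge> 1" for m k
  proof (induction k)
    case (Suc k)
    have "g (m + k * q + q) = g (m + k * q)"
      using g that by (simp add: admissible_def periodic_arith_def)
    then show ?case using Suc by (simp add: algebra_simps)
  qed simp
  have mult: "g (q * m) = g q" if "m \<ge> 1" for m
    using per[of q "m - 1"] that q2 by (cases m) (auto simp: algebra_simps)
  have one: "g m = 1" if "\<not> q dvd m" "m \<ge> 1" for m
  proof -
    have "coprime q m" using that q by (intro prime_imp_coprime)
    then have "g (q * m) = g q * g m"
      using g that q2 by (simp add: admissible_def multiplicative_arith_def)
    then show ?thesis using mult[OF that(2)] g by (simp add: admissible_def)
  qed
  have period: "(\<Sum>i=1..q. g i) = g q + of_nat (q - 1)"
  proof -
    have "(\<Sum>i=1..q. g i) = g q + (\<Sum>i=1..q-1. g i)"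
      using q2 by (cases q) (simp_all add: add.commute)
    also have "(\<Sum>i=1..q-1. g i) = (\<Sum>i=1..q-1. 1)"
      by (intro sum.cong one refl) (auto dest: dvd_imp_le)
    finally show ?thesis by simp
  qed
  have sums: "(\<Sum>i=1..k * q. g i) = of_nat k * (g q + of_nat (q - 1))" for k
  proof (induction k)
    case (Suc k)
    have "(\<Sum>i=1..Suc k * q. g i) = (\<Sum>i=1..k * q. g i) + (\<Sum>i=k * q + 1..k * q + q. g i)"
      using sum.ub_add_nat[of 1 "k * q" g q] by (simp add: add.commute)
    also have "(\<Sum>i=k * q + 1..k * q + q. g i) = (\<Sum>i=1..q. g (i + k * q))"
      using sum.shift_bounds_cl_nat_ivl[of g 1 "k * q" q] by (simp add: add.commute)
    also have "\<dots> = (\<Sum>i=1..q. g i)" by (intro sum.cong refl per) auto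
    finally show ?case using Suc period by (simp add: algebra_simps)
  qed simp
  obtain C where C: "\<And>x. x \<ge> 1 \<Longrightarrow> norm (summatory g x) \<le> C"
    using g by (auto simp: admissible_def bounded_partial_sums_def)
  have "g q + of_nat (q - 1) = 0"
  proof (rule ccontr)
    assume nz: "g q + of_nat (q - 1) \<noteq> 0"
    obtain k :: nat where k: "max 1 (C / norm (g q + of_nat (q - 1))) < real k"
      using reals_Archimedean2 by blast
    then have "C < real k * norm (g q + of_nat (q - 1))" using nz by (simp add: field_simps)
    also have "\<dots> = norm (summatory g (real (k * q)))"
      unfolding summatory_of_nat sums by (simp add: norm_mult)
    also have "\<dots> \<le> C"
    proof (rule C)
      have "1 \<le> k * q" using k q2 by (cases "k * q = 0") auto
      then show "1 \<le> real (k * q)" by linarith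
    qed
    finally show False by simp
  qed
  then have gq: "g q = 1 - of_nat q" using q2 by (simp add: of_nat_diff algebra_simps)
  show ?thesis
  proof (cases "q dvd n")
    case True
    then obtain m where "n = q * m" by (auto elim: dvdE)
    then show ?thesis using mult[of m] gq n by (cases m) (auto simp: period_fun_def)
  qed (use one n in \<open>auto simp: period_fun_def\<close>)
qed

lemma not_is_Omega_imp_small:
  assumes "\<not> is_Omega S g" "\<epsilon> > 0"
  shows "\<forall>\<^sub>F x in at_top. norm (S x) / g x < \<epsilon>"
proof -
  have "Limsup at_top (\<lambda>x. ereal (norm (S x) / g x)) < ereal \<epsilon>"
    using assms by (auto simp: is_Omega_def not_less intro: le_less_trans)
  from Limsup_lessD[OF this] show ?thesis by simp
qed

text \<open>
  If the \<open>\<Omega>\<close>-estimate failed, the kernel series at \<open>Complex \<delta> b\<close> would be at most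
  \<open>C + A * \<epsilon> / \<delta>\<close> for every \<open>\<epsilon> > 0\<close>, whereas the integral representation shows that it is at least
  \<open>c / \<delta>\<close> for small \<open>\<delta>\<close>. The choice \<open>\<epsilon> = c / (4 * A)\<close> makes the two incompatible.
\<close>
lemma is_Omega_summatory_conv_period_fun:
  assumes q: "q \<ge> 2"
  shows "is_Omega (summatory (dirichlet_conv (period_fun q) (period_fun q))) (\<lambda>x. x powr (1 / 4))"
proof (rule ccontr)
  assume contra: "\<not> ?thesis"
  define a where "a = dirichlet_conv (period_fun q) (period_fun q)"
  define b where "b = 2 * pi / real q"
  define A c \<epsilon> where "A = 8 * (1 + 1 / b) * (1 + b)" and "c = 1 / (2 * (1 + 2 * b\<^sup>2))" and "\<epsilon> = c / (4 * A)"
  have b: "b > 0" using q by (simp add: b_def)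
  have A: "A > 0" using b by (auto simp: A_def intro!: mult_pos_pos add_pos_pos)
  have c: "c > 0" by (simp add: c_def add_pos_nonneg)
  have \<epsilon>: "\<epsilon> > 0" using A c by (simp add: \<epsilon>_def)
  have "\<forall>\<^sub>F x in at_top. norm (summatory a x) / x powr (1 / 4) < \<epsilon>"
    using contra \<epsilon> unfolding a_def by (rule not_is_Omega_imp_small)
  then have "\<forall>\<^sub>F N in sequentially. norm (summatory a (real N)) / real N powr (1 / 4) < \<epsilon>"
    using filterlim_real_sequentially by (rule eventually_compose_filterlim)
  then obtain N0 where "\<And>N. N \<ge> N0 \<Longrightarrow> norm (summatory a (real N)) / real N powr (1 / 4) < \<epsilon>"
    by (auto simp: eventually_sequentially)
  then have small: "norm (\<Sum>n=1..N. a n) \<le> \<epsilon> * real N powr (1 / 4)" if "N \<ge> max N0 1" for N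
    using that by (fastforce simp: summatory_of_nat field_simps)
  obtain C where C: "\<And>\<delta> L. \<lbrakk>0 < \<delta>; \<delta> \<le> 1;
      (\<lambda>N. \<Sum>n=1..N. a n * bessel_kernel (Complex \<delta> b * of_real (sqrt (real n)))) \<longlonglongrightarrow> L\<rbrakk>
    \<Longrightarrow> norm L \<le> C + A * \<epsilon> / \<delta>"
    using norm_bessel_series_le[OF b \<epsilon> small] unfolding A_def by blast
  define \<delta> where "\<delta> n = inverse (real (Suc n))" for n
  define I where "I n = (\<integral>y. gen_product q (Complex (\<delta> n) b) y \<partial>lborel)" for n
  have \<delta>: "\<delta> n > 0" "\<delta> n \<le> 1" for n by (auto simp: \<delta>_def field_simps)
  have \<delta>0: "\<delta> \<longlonglongrightarrow> 0" unfolding \<delta>_def by (rule LIMSEQ_inverse_real_of_nat)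
  have lower: "\<forall>\<^sub>F n in sequentially. c \<le> \<delta> n * norm (I n)"
    using gen_product_integral_lower_bound[OF q \<delta>(1) \<delta>0] by (simp add: c_def b_def I_def)
  have upper: "\<delta> n * norm (I n) \<le> C * \<delta> n + c / 4" for n
  proof -
    have "(\<lambda>N. \<Sum>n'=1..N. a n' * bessel_kernel (Complex (\<delta> n) b * of_real (sqrt (real n')))) \<longlonglongrightarrow> I n"
      unfolding a_def I_def using q \<delta>(1)[of n]
      by (intro bessel_series_tendsto) auto
    from C[OF \<delta> this] have "\<delta> n * norm (I n) \<le> \<delta> n * (C + A * \<epsilon> / \<delta> n)"
      using \<delta>(1)[of n] by (intro mult_left_mono) auto
    also have "\<dots> = C * \<delta> n + A * \<epsilon>" using \<delta>(1)[of n] by (simp add: algebra_simps)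
    also have "A * \<epsilon> = c / 4" using A by (simp add: \<epsilon>_def)
    finally show ?thesis .
  qed
  have "(\<lambda>n. C * \<delta> n + c / 4) \<longlonglongrightarrow> c / 4"
    using tendsto_add[OF tendsto_mult_left[OF \<delta>0, of C] tendsto_const[of "c / 4"]] by simp
  moreover have "c / 4 < c" using c by simp
  ultimately have "\<forall>\<^sub>F n in sequentially. C * \<delta> n + c / 4 < c" by (rule order_tendstoD(2))
  with lower have "\<forall>\<^sub>F n in sequentially. False"
  proof eventually_elim
    case (elim n)
    then show ?case using upper[of n] by linarith
  qed
  then show False by simp
qed

theorem proposition3p1:
  fixes q :: nat
  assumes "prime q" and "q \<ge> 5"
  shows "(\<exists>f. admissible q f \<and> (\<forall>g. admissible q g \<longrightarrow> (\<forall>n\<ge>1. g n = f n))) \<and>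
         (\<forall>f. admissible q f \<longrightarrow>
            is_Omega (summatory (dirichlet_conv f f)) (\<lambda>x. x powr (1 / 4)))"
proof (intro conjI allI impI)
  show "\<exists>f. admissible q f \<and> (\<forall>g. admissible q g \<longrightarrow> (\<forall>n\<ge>1. g n = f n))"
    using admissible_period_fun[OF assms(1)] admissible_unique[OF assms(1)] by blast
  fix f assume f: "admissible q f"
  have "dirichlet_conv f f n = dirichlet_conv (period_fun q) (period_fun q) n" if "n \<ge> 1" for n
    unfolding dirichlet_conv_def
  proof (intro sum.cong refl)
    fix d assume "d \<in> {d. d dvd n}"
    then obtain e where "n = d * e" by (auto elim: dvdE)
    then have "d \<ge> 1" "n div d \<ge> 1" using that by (auto simp: Suc_le_eq)
    then show "f d * f (n div d) = period_fun q d * period_fun q (n div d)"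
      using admissible_unique[OF assms(1) f] by simp
  qed
  then have "summatory (dirichlet_conv f f) = summatory (dirichlet_conv (period_fun q) (period_fun q))"
    unfolding summatory_def by (intro ext sum.cong) auto
  then show "is_Omega (summatory (dirichlet_conv f f)) (\<lambda>x. x powr (1 / 4))"
    using is_Omega_summatory_conv_period_fun[of q] assms(2) by simp
qed

end
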